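(* Let $K$ be a field of characteristic zero and let $\mathbb{I}_1 = K\langle x, \frac{d}{dx}, \int\rangle \subseteq \operatorname{End}_K(K[x])$ be the algebra of polynomial integro-differential operators over $K$. Then every $K$-algebra endomorphism $\sigma : \mathbb{I}_1 \to \mathbb{I}_1$ is an automorphism.
   Context: $K[x]$ is the polynomial algebra in one variable over a field $K$ of characteristic zero. $\mathbb{I}_1$ is the (unital, associative) $K$-subalgebra of $\operatorname{End}_K(K[x])$ generated by: the operator $x$ of multiplication by $x$, the derivation $\frac{d}{dx}$, and the integration operator $\int : K[x]\to K[x]$, the $K$-linear map with $x^n \mapsto \frac{x^{n+1}}{n+1}$ for all $n\ge 0$. Algebra endomorphisms are $K$-linear, multiplicative and send $1$ to $1$. *)

theory Defs
  imports "HOL-Computational_Algebra.Polynomial"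
begin

text \<open>The type \<open>'a :: field_char_0\<close> is the ground field \<open>K\<close>, and \<open>'a poly\<close> is \<open>K[x]\<close>.
  Operators on \<open>K[x]\<close> are functions; in \<open>End\<^sub>K(K[x])\<close> the product is composition, the unit
  is \<open>id\<close>, and addition and scalar multiplication are pointwise.\<close>

definition poly_End :: "('a::field_char_0 poly \<Rightarrow> 'a poly) set" where
  "poly_End = {f. Vector_Spaces.linear smult smult f}"

definition mult_x :: "'a::field_char_0 poly \<Rightarrow> 'a poly" where
  "mult_x p = [:0, 1:] * p"

definition poly_integral :: "'a::field_char_0 poly \<Rightarrow> 'a poly" where
  "poly_integral p = (\<Sum>n\<le>degree p. monom (coeff p n / of_nat (Suc n)) (Suc n))"

inductive_set gen_subalgebra :: "('a::field_char_0 poly \<Rightarrow> 'a poly) set \<Rightarrow> ('a poly \<Rightarrow> 'a poly) set"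
  for S where
  gen: "f \<in> S \<Longrightarrow> f \<in> gen_subalgebra S"
| one: "id \<in> gen_subalgebra S"
| add: "f \<in> gen_subalgebra S \<Longrightarrow> g \<in> gen_subalgebra S \<Longrightarrow> (\<lambda>p. f p + g p) \<in> gen_subalgebra S"
| scale: "f \<in> gen_subalgebra S \<Longrightarrow> (\<lambda>p. smult c (f p)) \<in> gen_subalgebra S"
| comp: "f \<in> gen_subalgebra S \<Longrightarrow> g \<in> gen_subalgebra S \<Longrightarrow> f \<circ> g \<in> gen_subalgebra S"

definition I1 :: "('a::field_char_0 poly \<Rightarrow> 'a poly) set" where
  "I1 = gen_subalgebra {mult_x, pderiv, poly_integral}"

text \<open>Maps between algebras of operators are total functions that matter only on the
  carrier \<open>A\<close>; their values outside \<open>A\<close> are unconstrained.\<close>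

definition algebra_endomorphism ::
  "('a::field_char_0 poly \<Rightarrow> 'a poly) set
    \<Rightarrow> (('a poly \<Rightarrow> 'a poly) \<Rightarrow> ('a poly \<Rightarrow> 'a poly)) \<Rightarrow> bool" where
  "algebra_endomorphism A \<sigma> \<longleftrightarrow>
     (\<forall>f\<in>A. \<sigma> f \<in> A) \<and>
     (\<forall>f\<in>A. \<forall>g\<in>A. \<sigma> (\<lambda>p. f p + g p) = (\<lambda>p. \<sigma> f p + \<sigma> g p)) \<and>
     (\<forall>c. \<forall>f\<in>A. \<sigma> (\<lambda>p. smult c (f p)) = (\<lambda>p. smult c (\<sigma> f p))) \<and>
     (\<forall>f\<in>A. \<forall>g\<in>A. \<sigma> (f \<circ> g) = \<sigma> f \<circ> \<sigma> g) \<and>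
     \<sigma> id = id"

definition algebra_automorphism ::
  "('a::field_char_0 poly \<Rightarrow> 'a poly) set
    \<Rightarrow> (('a poly \<Rightarrow> 'a poly) \<Rightarrow> ('a poly \<Rightarrow> 'a poly)) \<Rightarrow> bool" where
  "algebra_automorphism A \<sigma> \<longleftrightarrow> algebra_endomorphism A \<sigma> \<and> bij_betw \<sigma> A A"

lemma poly_End_iff:
  "f \<in> poly_End \<longleftrightarrow> (\<forall>p q. f (p + q) = f p + f q) \<and> (\<forall>c p. f (smult c p) = smult c (f p))"
  for f :: "'a::field_char_0 poly \<Rightarrow> 'a poly"
proof -
  have "vector_space (smult :: 'a \<Rightarrow> 'a poly \<Rightarrow> 'a poly)"
    by unfold_locales (simp_all add: smult_add_right smult_add_left)
  then show ?thesis
    by (auto simp: poly_End_def Vector_Spaces.linear_iff)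
qed

lemma coeff_poly_integral:
  "coeff (poly_integral p) n = (case n of 0 \<Rightarrow> 0 | Suc m \<Rightarrow> coeff p m / of_nat (Suc m))"
proof (cases n)
  case 0
  then show ?thesis by (simp add: poly_integral_def coeff_sum)
next
  case (Suc m)
  have "coeff (poly_integral p) n
      = (\<Sum>i\<le>degree p. if i = m then coeff p i / of_nat (Suc i) else 0)"
    by (simp add: poly_integral_def coeff_sum Suc del: of_nat_Suc)
  also have "\<dots> = coeff p m / of_nat (Suc m)"
    by (cases "m \<le> degree p") (simp_all add: coeff_eq_0 del: of_nat_Suc)
  finally show ?thesis by (simp add: Suc)
qed

lemma poly_integral_power:
  "poly_integral (monom 1 n) = monom (1 / of_nat (n + 1)) (n + 1)"
  by (rule poly_eqI) (simp add: coeff_poly_integral split: nat.split)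

lemma generators_in_poly_End:
  "mult_x \<in> poly_End" "pderiv \<in> poly_End" "poly_integral \<in> poly_End"
  by (auto simp: poly_End_iff mult_x_def pderiv_add pderiv_smult distrib_left coeff_poly_integral
      add_divide_distrib intro!: poly_eqI split: nat.split)

lemma I1_subset_poly_End: "I1 \<subseteq> poly_End"
proof
  fix f :: "'a poly \<Rightarrow> 'a poly"
  assume "f \<in> I1"
  then have "f \<in> gen_subalgebra {mult_x, pderiv, poly_integral}"
    by (simp add: I1_def)
  then show "f \<in> poly_End"
  proof induction
    case (gen f)
    then show ?case using generators_in_poly_End by auto
  qed (auto simp: poly_End_iff smult_add_right mult.commute)
qed

end

theory Submission
  imports Defs
begin

text \<open>
  Write \<open>d\<close>, \<open>I\<close>, \<open>H = d x\<close> for \<open>pderiv\<close>, \<open>poly_integral\<close>, \<open>euler\<close>. These three generate the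
  algebra, since \<open>x = I H\<close>. An endomorphism \<open>\<sigma>\<close> turns them into operators \<open>a\<close>, \<open>b\<close>, \<open>h\<close> with
  \<open>a b = 1\<close>, \<open>h a = a h - a\<close>, \<open>h b = b h + b\<close>, and \<open>h = 1\<close> on the kernel of \<open>a\<close> (the last relation
  is the image of \<open>H (1 - I d) = 1 - I d\<close>). The theorem says that such a triple inside the algebra
  is conjugate to the standard one, up to a scalar, by a unit of the algebra.

  Modulo operators that kill all large powers of \<open>x\<close>, the algebra is a skew Laurent polynomial
  ring in \<open>d\<close> with coefficients polynomial in \<open>H\<close>. An element of it is a \<^emph>\<open>symbol\<close>: a finitely
  supported family of polynomials \<open>P\<^sub>e\<close> with \<open>x\<^sub>j \<mapsto> \<Sum>\<^sub>e P\<^sub>e(j) x\<^bsub>j+e\<^esub>\<close> for large \<open>j\<close>, in the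
  basis \<open>x\<^sub>j = x\<^sup>j/j!\<close> (\<open>divpow\<close>).
  Comparing top and bottom terms in \<open>a b = 1\<close> shows that \<open>a\<close> is \<open>c d\<^sup>i\<close> and \<open>b\<close> is \<open>c\<^sup>-\<^sup>1 I\<^sup>i\<close> up
  to finite corrections, where \<open>i\<close> is an integer and negative powers of \<open>d\<close> are powers of \<open>I\<close>.
  The relation \<open>h a = a h - a\<close> then forces \<open>i \<noteq> 0\<close>, the diagonal part \<open>j/i + const\<close> of the symbol
  of \<open>h\<close>, and constant off-diagonal parts.

  The rest is finite-dimensional linear algebra on polynomials of bounded degree. A dimension
  count gives \<open>i > 0\<close> and a nonzero \<open>u\<close> with \<open>a u = 0\<close>. The vectors \<open>b\<^sup>n u\<close> are eigenvectors of \<open>h\<close>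
  with eigenvalue \<open>n + 1\<close>, and only finitely many eigenvalues can occur in bounded degree. So the
  degrees of these vectors are unbounded, which excludes degree-raising terms in \<open>h\<close>; and as the
  degree of an eigenvector in large degree is determined by its eigenvalue, the kernel of \<open>a\<close> is
  a line and \<open>i = 1\<close> (\<open>symbols_of_triple\<close>). Moreover \<open>a\<close> is locally nilpotent: if \<open>g\<close> is the
  minimal polynomial of \<open>a\<close> on a space stable under \<open>a\<close> and \<open>h\<close>, the commutator of \<open>h\<close> with \<open>g(a)\<close>
  shows that \<open>X g' - (deg g) g\<close> annihilates it too, so \<open>g\<close> is a power of \<open>X\<close>
  (\<open>nilpotent_on_below\<close>). Therefore \<open>x\<^sup>n/n! \<mapsto> b\<^sup>n u\<close> is a bijection of \<open>K[x]\<close> that conjugates \<open>d\<close>,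
  \<open>I\<close>, \<open>H\<close> into \<open>a\<close>, \<open>b\<close>, \<open>h\<close> (\<open>intertwining_orbit_map\<close>), and \<open>\<sigma>\<close> is injective.

  For surjectivity the conjugating map has to lie in the algebra. Rescale \<open>a\<close> and \<open>b\<close> so that
  \<open>c = 1\<close>. The coefficients of \<open>b\<^sup>n u\<close> of large index are constant along diagonals, whereas its
  coefficients of small index run through an orbit of a linear map on a finite-dimensional space.
  Along this orbit the step can be reversed linearly, so the eigenvector equation for \<open>h\<close> becomes
  an eigenvector equation with eigenvalue \<open>n + 1\<close> for one fixed operator on that space; hence the
  coefficients of small index vanish for large \<open>n\<close> (\<open>low_part_vanishes\<close>). Comparing lowest terms
  in the eigenvector equation, \<open>b\<^sup>n u\<close> must be a multiple of a single power of \<open>x\<close>. The conjugating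
  map is thus a multiple of a shift on all large powers of \<open>x\<close>, so it and its inverse belong to
  the algebra (\<open>intertwining_unit\<close>), and its conjugates of the generators, which are scalar
  multiples of \<open>a\<close>, \<open>b\<close>, and \<open>b h\<close>, generate the whole algebra.
\<close>

section \<open>Linear operators and polynomials of bounded degree\<close>

lemma
  assumes "f \<in> poly_End"
  shows poly_End_add: "f (p + q) = f p + f q"
    and poly_End_smult: "f (smult c p) = smult c (f p)"
    and poly_End_0: "f 0 = 0"
    and poly_End_diff: "f (p - q) = f p - f q"
proof -
  show add: "f (p + q) = f p + f q" for p q
    using assms by (simp add: poly_End_iff)
  show sc: "f (smult c p) = smult c (f p)" for c p
    using assms by (simp add: poly_End_iff)
  show "f 0 = 0"
    using sc[of 0 0] by simp
  have minus: "f (- p) = - f p" for p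
    using sc[of "-1" p] by simp
  show "f (p - q) = f p - f q"
    using add[of p "- q"] by (simp add: minus)
qed

lemma poly_End_sum:
  assumes "f \<in> poly_End"
  shows "f (\<Sum>i\<in>A. g i) = (\<Sum>i\<in>A. f (g i))"
  by (induction A rule: infinite_finite_induct)
    (simp_all add: poly_End_0[OF assms] poly_End_add[OF assms])

lemma poly_End_I:
  assumes "\<And>p q. f (p + q) = f p + f q" "\<And>c p. f (smult c p) = smult c (f p)"
  shows "f \<in> poly_End"
  using assms by (simp add: poly_End_iff)

lemma poly_End_id: "id \<in> poly_End"
  by (rule poly_End_I) simp_all

lemma poly_End_plus: "f \<in> poly_End \<Longrightarrow> g \<in> poly_End \<Longrightarrow> (\<lambda>p. f p + g p) \<in> poly_End"
  by (rule poly_End_I) (simp_all add: poly_End_add poly_End_smult smult_add_right)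

lemma poly_End_scale: "f \<in> poly_End \<Longrightarrow> (\<lambda>p. smult c (f p)) \<in> poly_End"
  by (rule poly_End_I) (simp_all add: poly_End_add poly_End_smult smult_add_right mult.commute)

lemma poly_End_comp: "f \<in> poly_End \<Longrightarrow> g \<in> poly_End \<Longrightarrow> f \<circ> g \<in> poly_End"
  by (rule poly_End_I) (simp_all add: poly_End_add poly_End_smult)

lemma poly_End_funpow: "f \<in> poly_End \<Longrightarrow> f ^^ n \<in> poly_End"
  by (induction n) (simp_all add: poly_End_id poly_End_comp)

text \<open>The basis \<open>x\<^sup>n/n!\<close> makes \<open>pderiv\<close> and \<open>poly_integral\<close> pure shifts.\<close>

definition divpow :: "nat \<Rightarrow> 'a::field_char_0 poly" where
  "divpow n = monom (1 / fact n) n"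

text \<open>Coordinates with respect to the basis \<open>divpow\<close>.\<close>

definition dcoeff :: "'a::field_char_0 poly \<Rightarrow> nat \<Rightarrow> 'a" where
  "dcoeff p i = fact i * coeff p i"

lemma dcoeff_simps [simp]:
  "dcoeff 0 i = 0" "dcoeff (p + q) i = dcoeff p i + dcoeff q i"
  "dcoeff (p - q) i = dcoeff p i - dcoeff q i" "dcoeff (- p) i = - dcoeff p i"
  "dcoeff (smult c p) i = c * dcoeff p i"
  by (simp_all add: dcoeff_def algebra_simps)

lemma dcoeff_sum: "dcoeff (\<Sum>k\<in>A. f k) i = (\<Sum>k\<in>A. dcoeff (f k) i)"
  by (induction A rule: infinite_finite_induct) simp_all

lemma dcoeff_divpow [simp]: "dcoeff (divpow n) i = (if i = n then 1 else 0)"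
  by (auto simp: dcoeff_def divpow_def)

lemma dcoeff_eq_0_iff: "dcoeff p i = 0 \<longleftrightarrow> coeff p i = 0"
  by (simp add: dcoeff_def)

lemma poly_eqI_dcoeff: "(\<And>i. dcoeff p i = dcoeff q i) \<Longrightarrow> p = q"
  by (rule poly_eqI) (simp add: dcoeff_def)

lemma pderiv_divpow: "pderiv (divpow n) = (if n = 0 then 0 else divpow (n - 1))"
  by (cases n) (simp_all add: divpow_def pderiv_monom del: of_nat_Suc)

lemma integral_divpow: "poly_integral (divpow n) = divpow (Suc n)"
  by (rule poly_eqI) (auto simp: divpow_def coeff_poly_integral split: nat.split)

lemma mult_x_divpow: "mult_x (divpow n) = smult (of_nat (Suc n)) (divpow (Suc n))"
  by (simp add: mult_x_def divpow_def mult_monom monom_Suc[symmetric] smult_monom del: of_nat_Suc)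

text \<open>A degree bound that treats the zero polynomial uniformly: \<open>below 0\<close> is the zero space and
  \<open>below n\<close> has dimension \<open>n\<close>.\<close>

definition below :: "nat \<Rightarrow> 'a::field_char_0 poly set" where
  "below n = {p. \<forall>i\<ge>n. dcoeff p i = 0}"

lemma below_I: "(\<And>i. i \<ge> n \<Longrightarrow> dcoeff p i = 0) \<Longrightarrow> p \<in> below n"
  by (simp add: below_def)

lemma below_D: "p \<in> below n \<Longrightarrow> n \<le> i \<Longrightarrow> dcoeff p i = 0"
  by (simp add: below_def)

lemma below_mono: "p \<in> below m \<Longrightarrow> m \<le> n \<Longrightarrow> p \<in> below n"
  by (auto simp: below_def)

lemma below_closed:
  "0 \<in> below n" "p \<in> below n \<Longrightarrow> q \<in> below n \<Longrightarrow> p + q \<in> below n"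
  "p \<in> below n \<Longrightarrow> q \<in> below n \<Longrightarrow> p - q \<in> below n"
  "p \<in> below n \<Longrightarrow> smult c p \<in> below n"
  by (simp_all add: below_def)

lemma below_sum: "(\<And>k. k \<in> A \<Longrightarrow> f k \<in> below n) \<Longrightarrow> (\<Sum>k\<in>A. f k) \<in> below n"
  by (simp add: below_def dcoeff_sum)

lemma divpow_below: "i < n \<Longrightarrow> divpow i \<in> below n"
  by (simp add: below_def)

lemma ex_below: "\<exists>n. p \<in> below n"
  by (rule exI[of _ "Suc (degree p)"]) (simp add: below_def dcoeff_eq_0_iff coeff_eq_0)

lemma finite_ex_below: fixes k :: nat shows "\<exists>n. \<forall>j<k. f j \<in> below n"
proof (induction k)
  case (Suc k)
  then obtain n where n: "\<forall>j<k. f j \<in> below n" by blast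
  obtain n' where "f k \<in> below n'" using ex_below by blast
  then show ?case
    using n by (intro exI[of _ "max n n'"]) (auto simp: less_Suc_eq intro: below_mono)
qed auto

lemma smult_sum_right: "smult c (\<Sum>i\<in>A. f i) = (\<Sum>i\<in>A. smult c (f i))"
  by (induction A rule: infinite_finite_induct) (simp_all add: smult_add_right)

lemma divpow_expansion:
  assumes "p \<in> below n"
  shows "p = (\<Sum>i<n. smult (dcoeff p i) (divpow i))"
proof (rule poly_eqI_dcoeff)
  fix i
  have "dcoeff (\<Sum>i<n. smult (dcoeff p i) (divpow i)) i
      = (\<Sum>k<n. if i = k then dcoeff p k else 0)"
    unfolding dcoeff_sum by (intro sum.cong) auto
  then show "dcoeff p i = dcoeff (\<Sum>i<n. smult (dcoeff p i) (divpow i)) i"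
    using assms by (auto simp: below_def)
qed

lemma poly_End_expansion:
  assumes "f \<in> poly_End" "p \<in> below n"
  shows "f p = (\<Sum>i<n. smult (dcoeff p i) (f (divpow i)))"
  using divpow_expansion[OF assms(2)] poly_End_sum[OF assms(1)] poly_End_smult[OF assms(1)]
  by (metis (no_types, lifting) sum.cong)

lemma poly_End_eqI:
  assumes "f \<in> poly_End" "g \<in> poly_End" "\<And>n. f (divpow n) = g (divpow n)"
  shows "f = g"
proof
  fix p :: "'a poly"
  obtain n where "p \<in> below n" using ex_below by blast
  then show "f p = g p"
    by (simp add: poly_End_expansion[OF assms(1)] poly_End_expansion[OF assms(2)] assms(3))
qed

lemma poly_End_below:
  assumes "f \<in> poly_End" "\<And>i. i < n \<Longrightarrow> f (divpow i) \<in> below m" "p \<in> below n"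
  shows "f p \<in> below m"
  unfolding poly_End_expansion[OF assms(1,3)]
  by (intro below_sum below_closed assms(2)) simp

lemma nonzero_top:
  fixes p :: "'a::field_char_0 poly"
  assumes "p \<noteq> 0"
  obtains n where "dcoeff p n \<noteq> 0" "p \<in> below (Suc n)"
  using assms
  by (intro that[of "degree p"]) (auto simp: dcoeff_eq_0_iff below_def coeff_eq_0)

text \<open>The linear map that sends the basis \<open>divpow\<close> to prescribed vectors; the bound in the sum is
  only there to make it finite, see \<open>combination_below\<close>.\<close>

definition combination :: "(nat \<Rightarrow> 'a::field_char_0 poly) \<Rightarrow> 'a poly \<Rightarrow> 'a poly" where
  "combination v p = (\<Sum>k\<le>degree p. smult (dcoeff p k) (v k))"

lemma combination_below:
  assumes "p \<in> below n"
  shows "combination v p = (\<Sum>k<n. smult (dcoeff p k) (v k))"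
proof -
  have "combination v p = (\<Sum>k<max n (Suc (degree p)). smult (dcoeff p k) (v k))"
    unfolding combination_def
    by (rule sum.mono_neutral_left) (auto simp: dcoeff_eq_0_iff coeff_eq_0)
  also have "\<dots> = (\<Sum>k<n. smult (dcoeff p k) (v k))"
    by (rule sum.mono_neutral_right) (use assms in \<open>auto simp: below_def\<close>)
  finally show ?thesis .
qed

lemma combination_End: "combination v \<in> poly_End"
proof (rule poly_End_I)
  fix p q :: "'a poly" and c
  obtain m n where "p \<in> below m" "q \<in> below n" using ex_below by meson
  then have *: "p \<in> below (max m n)" "q \<in> below (max m n)"
    by (auto intro: below_mono)
  show "combination v (p + q) = combination v p + combination v q"
    by (simp add: combination_below[OF *(1)] combination_below[OF *(2)]
        combination_below[OF below_closed(2)[OF *]] smult_add_left sum.distrib)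
  show "combination v (smult c p) = smult c (combination v p)"
    by (simp add: combination_below[OF *(1)] combination_below[OF below_closed(4)[OF *(1)]]
        smult_sum_right)
qed

lemma combination_divpow [simp]: "combination v (divpow n) = v n"
proof -
  have "combination v (divpow n) = (\<Sum>k<Suc n. if k = n then v k else 0)"
    unfolding combination_below[OF divpow_below[OF lessI]] by (intro sum.cong) auto
  then show ?thesis by simp
qed

text \<open>The only form in which dimension is used below: otherwise the images of the \<open>n\<close> basis
  vectors would be independent in the span of \<open>m\<close> vectors.\<close>

lemma exists_kernel:
  fixes f :: "'a::field_char_0 poly \<Rightarrow> 'a poly"
  assumes f: "f \<in> poly_End" and fm: "\<And>p. p \<in> below n \<Longrightarrow> f p \<in> below m" and "m < n"
  shows "\<exists>p\<in>below n. p \<noteq> 0 \<and> f p = 0"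
proof (rule ccontr)
  assume "\<not> ?thesis"
  then have ker: "\<And>p. p \<in> below n \<Longrightarrow> f p = 0 \<Longrightarrow> p = 0" by blast
  interpret vector_space "smult :: 'a \<Rightarrow> 'a poly \<Rightarrow> 'a poly"
    by unfold_locales (simp_all add: smult_add_right smult_add_left)
  define g where "g i = f (divpow i)" for i
  have inj: "inj_on g {..<n}"
  proof (rule inj_onI)
    fix i j assume ij: "i \<in> {..<n}" "j \<in> {..<n}" "g i = g j"
    then have "f (divpow i - divpow j) = 0" "divpow i - divpow j \<in> below n"
      by (auto simp: g_def poly_End_diff[OF f] intro!: below_closed divpow_below)
    then have "divpow i - divpow j = (0 :: 'a poly)"
      by (rule ker[rotated])
    then show "i = j"
      by (metis dcoeff_divpow eq_iff_diff_eq_0 one_neq_zero)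
  qed
  have "independent (g ` {..<n})"
  proof (rule independent_if_scalars_zero)
    fix c x assume s: "(\<Sum>x\<in>g ` {..<n}. smult (c x) x) = 0" and x: "x \<in> g ` {..<n}"
    define p where "p = (\<Sum>i<n. smult (c (g i)) (divpow i))"
    have p: "p \<in> below n"
      unfolding p_def by (intro below_sum below_closed divpow_below) simp
    have "f p = (\<Sum>i<n. smult (c (g i)) (g i))"
      by (simp add: p_def poly_End_sum[OF f] poly_End_smult[OF f] g_def)
    also have "\<dots> = 0"
      using s by (simp add: sum.reindex[OF inj])
    finally have "p = 0" using ker[OF p] by simp
    moreover obtain i where i: "i < n" "x = g i" using x by auto
    have "dcoeff p i = (\<Sum>k<n. if i = k then c (g k) else 0)"
      unfolding p_def dcoeff_sum by (intro sum.cong) auto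
    ultimately show "c x = 0"
      using i by simp
  qed simp
  moreover have "g ` {..<n} \<subseteq> span (divpow ` {..<m})"
  proof
    fix x assume "x \<in> g ` {..<n}"
    then obtain i where i: "i < n" "x = f (divpow i)" by (auto simp: g_def)
    then have "x \<in> below m" using fm[OF divpow_below] by simp
    from divpow_expansion[OF this] show "x \<in> span (divpow ` {..<m})"
      by (metis (no_types, lifting) imageI span_base span_scale span_sum)
  qed
  ultimately have "card (g ` {..<n}) \<le> card (divpow ` {..<m} :: 'a poly set)"
    using independent_span_bound[of "divpow ` {..<m}"] by blast
  also have "\<dots> \<le> m" using card_image_le[of "{..<m}"] by fastforce
  finally show False using \<open>m < n\<close> by (simp add: card_image[OF inj])
qed

lemma eigenvectors_independent:
  assumes h: "h \<in> poly_End" and "finite S"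
    and "\<And>e. e \<in> S \<Longrightarrow> h (w e) = smult (of_nat e) (w e)" and "(\<Sum>e\<in>S. w e) = 0"
  shows "\<forall>e\<in>S. w e = 0"
  using assms(2-)
proof (induction S arbitrary: w rule: finite_induct)
  case (insert k S)
  \<comment> \<open>Applying \<open>h - k\<close> to the relation removes the \<open>k\<close>-th term.\<close>
  define w' where "w' e = smult (of_nat e - of_nat k) (w e)" for e
  have "(\<Sum>e\<in>insert k S. w' e)
      = (\<Sum>e\<in>insert k S. h (w e)) - smult (of_nat k) (\<Sum>e\<in>insert k S. w e)"
    unfolding smult_sum_right sum_subtractf[symmetric]
    by (intro sum.cong) (simp_all add: w'_def insert.prems(1) smult_diff_left)
  also have "\<dots> = 0"
    by (simp only: poly_End_sum[OF h, symmetric] insert.prems(2) poly_End_0[OF h]) simp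
  finally have "(\<Sum>e\<in>S. w' e) = 0"
    using insert.hyps by (simp add: w'_def)
  moreover have "\<And>e. e \<in> S \<Longrightarrow> h (w' e) = smult (of_nat e) (w' e)"
    by (simp add: w'_def poly_End_smult[OF h] insert.prems(1) mult.commute)
  ultimately have "\<forall>e\<in>S. w' e = 0" by (rule insert.IH[rotated])
  then have "\<forall>e\<in>S. w e = 0"
    using insert.hyps(2) by (auto simp: w'_def)
  then show ?case
    using insert.prems(2) insert.hyps by simp
qed simp

text \<open>Eigenvectors to distinct eigenvalues are independent, so at most \<open>m\<close> of them fit into
  \<open>below m\<close>. The operator need not preserve that space.\<close>

lemma finite_eigenvalues:
  fixes h :: "'a::field_char_0 poly \<Rightarrow> 'a poly"
  assumes h: "h \<in> poly_End"
  shows "finite {e::nat. \<exists>w\<in>below m. w \<noteq> 0 \<and> h w = smult (of_nat e) w}" (is "finite ?E")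
proof (rule ccontr)
  assume inf: "infinite ?E"
  define en where "en = enumerate ?E"
  have en: "en k \<in> ?E" for k using enumerate_in_set[OF inf] by (simp add: en_def)
  have inj: "inj en"
    unfolding en_def by (rule strict_mono_imp_inj_on, rule strict_monoI, rule enumerate_mono[OF _ inf])
  have "\<forall>k. \<exists>w. w \<in> below m \<and> w \<noteq> 0 \<and> h w = smult (of_nat (en k)) w"
    using en by blast
  then obtain w where w: "\<And>k. w k \<in> below m" "\<And>k. w k \<noteq> 0"
      "\<And>k. h (w k) = smult (of_nat (en k)) (w k)"
    by metis
  obtain p where p: "p \<in> below (Suc m)" "p \<noteq> 0" "combination w p = 0"
  proof -
    have "combination w q \<in> below m" if "q \<in> below (Suc m)" for q
      using w(1) by (auto intro: poly_End_below[OF combination_End _ that])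
    from exists_kernel[OF combination_End this lessI] that show thesis by blast
  qed
  define w' where "w' e = smult (dcoeff p (inv en e)) (w (inv en e))" for e
  have "(\<Sum>e\<in>en ` {..<Suc m}. w' e) = combination w p"
    by (subst sum.reindex) (auto simp: combination_below[OF p(1)] w'_def inj inv_f_f[OF inj]
        inj_on_subset[OF inj] simp del: sum.lessThan_Suc)
  then have "\<forall>e\<in>en ` {..<Suc m}. w' e = 0"
    using p(3) by (intro eigenvectors_independent[OF h])
      (auto simp: w'_def inv_f_f[OF inj] poly_End_smult[OF h] w(3) mult.commute)
  then have "dcoeff p k = 0" if "k < Suc m" for k
    using that w(2)[of k] by (force simp: w'_def inv_f_f[OF inj])
  then have "p = 0" 
    by (metis (no_types) poly_eqI_dcoeff below_D[OF p(1)] dcoeff_simps(1) not_less)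
  then show False using p(2) by simp
qed

section \<open>Membership in the algebra and symbols at infinity\<close>

lemma integral_End: "poly_integral \<in> poly_End" and pderiv_End: "pderiv \<in> poly_End"
  and mult_x_End: "mult_x \<in> poly_End"
  using generators_in_poly_End by auto

lemma I1_End: "f \<in> I1 \<Longrightarrow> f \<in> poly_End"
  using I1_subset_poly_End by blast

lemma I1_closed:
  "mult_x \<in> I1" "pderiv \<in> I1" "poly_integral \<in> I1" "id \<in> I1"
  "f \<in> I1 \<Longrightarrow> g \<in> I1 \<Longrightarrow> (\<lambda>p. f p + g p) \<in> I1"
  "f \<in> I1 \<Longrightarrow> (\<lambda>p. smult c (f p)) \<in> I1"
  "f \<in> I1 \<Longrightarrow> g \<in> I1 \<Longrightarrow> f \<circ> g \<in> I1"
  unfolding I1_def by (auto intro: gen_subalgebra.intros)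

lemma I1_diff: "f \<in> I1 \<Longrightarrow> g \<in> I1 \<Longrightarrow> (\<lambda>p. f p - g p) \<in> I1"
  using I1_closed(5)[OF _ I1_closed(6)[of g "-1"], of f] by simp

lemma I1_funpow: "f \<in> I1 \<Longrightarrow> f ^^ n \<in> I1"
  by (induction n) (auto intro: I1_closed)

lemma I1_sum: "(\<And>i. i \<in> A \<Longrightarrow> f i \<in> I1) \<Longrightarrow> (\<lambda>p. \<Sum>i\<in>A. f i p) \<in> I1"
proof (induction A rule: infinite_finite_induct)
  case (insert x A)
  then show ?case by (simp add: I1_closed)
qed (use I1_closed(6)[OF I1_closed(4), of 0] in simp_all)

lemma pderiv_funpow_divpow: "(pderiv ^^ k) (divpow n) = (if k \<le> n then divpow (n - k) else 0)"
  by (induction k) (auto simp: pderiv_divpow Suc_diff_le)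

lemma integral_funpow_divpow: "(poly_integral ^^ k) (divpow n) = divpow (k + n)"
  by (induction k) (simp_all add: integral_divpow)

lemma dcoeff_End: "(\<lambda>p. smult (dcoeff p j) q) \<in> poly_End"
  by (rule poly_End_I) (simp_all add: smult_add_left)

text \<open>The operator \<open>1 - I d\<close> is the projection onto the constants; shifting its source by \<open>d\<^sup>j\<close> and
  its target by \<open>I\<^sup>i\<close> gives every matrix unit.\<close>

lemma matrix_unit_in_I1: "(\<lambda>p. smult (dcoeff p j) (divpow i)) \<in> I1"
proof -
  define e where "e = (\<lambda>p :: 'a poly. id p - (poly_integral \<circ> pderiv) p)"
  have e: "e \<in> I1"
    unfolding e_def by (intro I1_diff I1_closed)
  have "(poly_integral ^^ i) \<circ> e \<circ> (pderiv ^^ j) = (\<lambda>p. smult (dcoeff p j) (divpow i))"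
  proof (rule poly_End_eqI)
    show "(poly_integral ^^ i) \<circ> e \<circ> (pderiv ^^ j) \<in> poly_End"
      by (intro poly_End_comp poly_End_funpow I1_End[OF e] integral_End pderiv_End)
  next
    fix n
    have *: "e (divpow m) = (if m = 0 then divpow 0 else 0)" for m
      by (simp add: e_def pderiv_divpow integral_divpow poly_End_0[OF integral_End])
    show "((poly_integral ^^ i) \<circ> e \<circ> (pderiv ^^ j)) (divpow n)
        = smult (dcoeff (divpow n) j) (divpow i)"
      by (auto simp add: pderiv_funpow_divpow * poly_End_0[OF I1_End[OF e]]
          poly_End_0[OF poly_End_funpow[OF integral_End]] integral_funpow_divpow[of i 0, simplified])
  qed (rule dcoeff_End)
  then show ?thesis
    using e by (metis I1_closed(2,3,7) I1_funpow)
qed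

text \<open>Such an operator has a matrix with finitely many nonzero entries, because a polynomial has
  only finitely many coefficients.\<close>

lemma finitary_in_I1:
  assumes f: "f \<in> poly_End" and N: "\<And>j. j \<ge> N \<Longrightarrow> f (divpow j) = 0"
  shows "f \<in> I1"
proof -
  obtain m where m: "\<forall>j<N. f (divpow j) \<in> below m"
    using finite_ex_below[of N "\<lambda>j. f (divpow j)"] by blast
  define g where "g = (\<lambda>p. \<Sum>j<N. \<Sum>i<m. smult (dcoeff (f (divpow j)) i)
      (smult (dcoeff p j) (divpow i)))"
  have g: "g \<in> I1"
    unfolding g_def by (intro I1_sum I1_closed(6) matrix_unit_in_I1)
  have "f = g"
  proof (rule poly_End_eqI[OF f I1_End[OF g]])
    fix n
    have "g (divpow n) = (\<Sum>j<N. if j = n then f (divpow j) else 0)"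
      unfolding g_def using m
      by (intro sum.cong) (auto simp: divpow_expansion[symmetric])
    then show "f (divpow n) = g (divpow n)"
      using N[of n] by (simp add: not_le)
  qed
  with g show ?thesis by simp
qed

text \<open>Up to an operator as in \<open>finitary_in_I1\<close>, \<open>f\<close> is \<open>c I\<^sup>l d\<^sup>k\<close>.\<close>

lemma eventual_shift_in_I1:
  assumes f: "f \<in> poly_End"
    and N: "\<And>j. j \<ge> N \<Longrightarrow> f (divpow (k + j)) = smult c (divpow (l + j))"
  shows "f \<in> I1"
proof -
  define g where "g = (\<lambda>p. smult c (((poly_integral ^^ l) \<circ> (pderiv ^^ k)) p))"
  have g: "g \<in> I1"
    unfolding g_def by (intro I1_closed I1_funpow)
  have "(\<lambda>p. f p - g p) \<in> I1"
  proof (rule finitary_in_I1)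
    show "(\<lambda>p. f p - g p) \<in> poly_End"
      using poly_End_plus[OF f poly_End_scale[OF I1_End[OF g], of "-1"]] by simp
    fix j assume "j \<ge> k + N"
    then obtain m where "j = k + m" "m \<ge> N"
      by (metis add_le_cancel_left le_iff_add le_add1 order_trans)
    then show "f (divpow j) - g (divpow j) = 0"
      by (simp add: N g_def pderiv_funpow_divpow integral_funpow_divpow)
  qed
  from I1_closed(5)[OF this g] show ?thesis by simp
qed

text \<open>The symbol of an operator is its class modulo operators that kill all large powers of \<open>x\<close>.
  The component of index \<open>d\<close> is the polynomial that gives the matrix entries on the \<open>d\<close>-th
  diagonal, except for finitely many columns.\<close>

definition has_symbol ::
  "('a::field_char_0 poly \<Rightarrow> 'a poly) \<Rightarrow> (int \<Rightarrow> 'a poly) \<Rightarrow> bool" where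
  "has_symbol f P \<longleftrightarrow> f \<in> poly_End \<and> finite {d. P d \<noteq> 0} \<and>
     (\<exists>N. \<forall>j\<ge>N. \<forall>i. dcoeff (f (divpow j)) i = poly (P (int i - int j)) (of_nat j))"

text \<open>Multiplication in the skew Laurent polynomial ring: the right factor moves \<open>j\<close> to \<open>j + e\<close>
  before the coefficient of the left factor is evaluated.\<close>

definition symbol_mult :: "(int \<Rightarrow> 'a::field_char_0 poly) \<Rightarrow> (int \<Rightarrow> 'a poly) \<Rightarrow> int \<Rightarrow> 'a poly" where
  "symbol_mult P Q d = (\<Sum>e | Q e \<noteq> 0. pcompose (P (d - e)) [:of_int e, 1:] * Q e)"

lemma finite_int_bound:
  assumes "finite (S :: int set)"
  obtains M :: nat where "\<And>d. d \<in> S \<Longrightarrow> \<bar>d\<bar> \<le> int M"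
proof -
  obtain k where "\<forall>d\<in>S. \<bar>d\<bar> \<le> k"
    using finite_imageI[OF assms, of abs] by (meson Max_ge finite_imageI assms imageI)
  then show thesis by (intro that[of "nat k"]) force
qed

lemma symbol_expansion:
  assumes "has_symbol f P" "finite S" "{d. P d \<noteq> 0} \<subseteq> S"
  obtains N where "\<And>j d. j \<ge> N \<Longrightarrow> d \<in> S \<Longrightarrow> 0 \<le> int j + d"
    and "\<And>j. j \<ge> N \<Longrightarrow> f (divpow j) = (\<Sum>d\<in>S. smult (poly (P d) (of_nat j)) (divpow (nat (int j + d))))"
proof -
  obtain N where N: "\<And>j i. j \<ge> N \<Longrightarrow> dcoeff (f (divpow j)) i = poly (P (int i - int j)) (of_nat j)"
    using assms(1) by (auto simp: has_symbol_def)
  obtain M where M: "\<And>d. d \<in> S \<Longrightarrow> \<bar>d\<bar> \<le> int M"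
    using finite_int_bound[OF assms(2)] by blast
  have nonneg: "0 \<le> int j + d" if "j \<ge> max M N" "d \<in> S" for j d
    using M[OF that(2)] that(1) by linarith
  show thesis
  proof (rule that[of "max M N"])
    fix j assume j: "j \<ge> max M N"
    show "f (divpow j) = (\<Sum>d\<in>S. smult (poly (P d) (of_nat j)) (divpow (nat (int j + d))))"
    proof (rule poly_eqI_dcoeff)
      fix i
      have "dcoeff (\<Sum>d\<in>S. smult (poly (P d) (of_nat j)) (divpow (nat (int j + d)))) i
          = (\<Sum>d\<in>S. if d = int i - int j then poly (P d) (of_nat j) else 0)"
        unfolding dcoeff_sum using nonneg[OF j] by (intro sum.cong) force+
      also have "\<dots> = poly (P (int i - int j)) (of_nat j)"
        using assms(2,3) by (cases "P (int i - int j) = 0") (auto simp: subset_iff)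
      finally show "dcoeff (f (divpow j)) i
          = dcoeff (\<Sum>d\<in>S. smult (poly (P d) (of_nat j)) (divpow (nat (int j + d)))) i"
        using N j by simp
    qed
  qed (use nonneg in auto)
qed

lemma poly_eqI_of_nat:
  fixes p q :: "'a::field_char_0 poly"
  assumes "\<And>j. j \<ge> N \<Longrightarrow> poly p (of_nat j) = poly q (of_nat j)"
  shows "p = q"
proof (rule ccontr)
  assume "p \<noteq> q"
  then have "finite {x. poly (p - q) x = 0}" by (intro poly_roots_finite) simp
  moreover have "of_nat ` {N..} \<subseteq> {x. poly (p - q) x = 0}" using assms by auto
  moreover have "infinite (of_nat ` {N..} :: 'a set)"
    by (simp add: finite_image_iff inj_on_def infinite_Ici)
  ultimately show False using finite_subset by blast
qed

lemma symbol_unique: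
  assumes "has_symbol f P" "has_symbol f Q"
  shows "P = Q"
proof
  fix d
  obtain N where N: "\<And>j i. j \<ge> N \<Longrightarrow> dcoeff (f (divpow j)) i = poly (P (int i - int j)) (of_nat j)"
    using assms(1) by (auto simp: has_symbol_def)
  obtain N' where N': "\<And>j i. j \<ge> N' \<Longrightarrow> dcoeff (f (divpow j)) i = poly (Q (int i - int j)) (of_nat j)"
    using assms(2) by (auto simp: has_symbol_def)
  show "P d = Q d"
  proof (rule poly_eqI_of_nat)
    fix j assume "j \<ge> max (max N N') (nat \<bar>d\<bar>)"
    then have "j \<ge> N" "j \<ge> N'" "int (nat (int j + d)) - int j = d" by linarith+
    then show "poly (P d) (of_nat j) = poly (Q d) (of_nat j)"
      using N[of j "nat (int j + d)"] N'[of j "nat (int j + d)"] by simp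
  qed
qed

lemma symbol_plus:
  assumes "has_symbol f P" "has_symbol g Q"
  shows "has_symbol (\<lambda>p. f p + g p) (\<lambda>d. P d + Q d)"
proof -
  obtain N where N: "\<And>j i. j \<ge> N \<Longrightarrow> dcoeff (f (divpow j)) i = poly (P (int i - int j)) (of_nat j)"
    using assms(1) by (auto simp: has_symbol_def)
  obtain N' where N': "\<And>j i. j \<ge> N' \<Longrightarrow> dcoeff (g (divpow j)) i = poly (Q (int i - int j)) (of_nat j)"
    using assms(2) by (auto simp: has_symbol_def)
  have "finite ({d. P d \<noteq> 0} \<union> {d. Q d \<noteq> 0})"
    using assms by (simp add: has_symbol_def)
  then have "finite {d. P d + Q d \<noteq> 0}" by (rule finite_subset[rotated]) auto
  then show ?thesis
    using assms N N' by (auto simp: has_symbol_def poly_End_plus intro!: exI[of _ "max N N'"])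
qed

lemma symbol_scale:
  assumes "has_symbol f P"
  shows "has_symbol (\<lambda>p. smult c (f p)) (\<lambda>d. smult c (P d))"
proof -
  have "finite {d. smult c (P d) \<noteq> 0}"
    using assms by (auto simp: has_symbol_def intro: finite_subset[rotated])
  then show ?thesis
    using assms by (auto simp: has_symbol_def poly_End_scale)
qed

lemma symbol_comp:
  assumes f: "has_symbol f P" and g: "has_symbol g Q"
  shows "has_symbol (f \<circ> g) (symbol_mult P Q)"
proof -
  have fe: "f \<in> poly_End" and ge: "g \<in> poly_End" using f g by (simp_all add: has_symbol_def)
  let ?S = "{e. Q e \<noteq> 0}"
  have fin: "finite ?S" "finite {d. P d \<noteq> 0}" using f g by (simp_all add: has_symbol_def)
  have "{d. symbol_mult P Q d \<noteq> 0} \<subseteq> (\<lambda>(d, e). d + e) ` ({d. P d \<noteq> 0} \<times> ?S)"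
  proof
    fix d assume "d \<in> {d. symbol_mult P Q d \<noteq> 0}"
    then obtain e where "e \<in> ?S" "pcompose (P (d - e)) [:of_int e, 1:] * Q e \<noteq> 0"
      unfolding symbol_mult_def by (metis (mono_tags, lifting) mem_Collect_eq sum.neutral)
    then have "(d - e, e) \<in> {d. P d \<noteq> 0} \<times> ?S" by auto
    then show "d \<in> (\<lambda>(d, e). d + e) ` ({d. P d \<noteq> 0} \<times> ?S)"
      by (rule rev_image_eqI) simp
  qed
  then have fin': "finite {d. symbol_mult P Q d \<noteq> 0}"
    using fin by (meson finite_SigmaI finite_imageI finite_subset)
  obtain N where N: "\<And>j i. j \<ge> N \<Longrightarrow> dcoeff (f (divpow j)) i = poly (P (int i - int j)) (of_nat j)"
    using f by (auto simp: has_symbol_def)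
  obtain M where M: "\<And>j d. j \<ge> M \<Longrightarrow> d \<in> ?S \<Longrightarrow> 0 \<le> int j + d"
    "\<And>j. j \<ge> M \<Longrightarrow> g (divpow j) = (\<Sum>d\<in>?S. smult (poly (Q d) (of_nat j)) (divpow (nat (int j + d))))"
    by (rule symbol_expansion[OF g fin(1) order_refl]) (rule that)
  obtain B where B: "\<And>d. d \<in> ?S \<Longrightarrow> \<bar>d\<bar> \<le> int B"
    using finite_int_bound[OF fin(1)] by blast
  have "dcoeff ((f \<circ> g) (divpow j)) i = poly (symbol_mult P Q (int i - int j)) (of_nat j)"
    if j: "j \<ge> max M (N + B)" for i j
  proof -
    have large: "nat (int j + d) \<ge> N" and cast: "of_nat (nat (int j + d)) = of_int d + (of_nat j :: 'a)"
      if "d \<in> ?S" for d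
    proof -
      have nn: "0 \<le> int j + d" and "\<bar>d\<bar> \<le> int B" using M(1)[of j d] B that j by auto
      then show "nat (int j + d) \<ge> N" using j by linarith
      show "of_nat (nat (int j + d)) = of_int d + (of_nat j :: 'a)" using nn by simp
    qed
    have "dcoeff ((f \<circ> g) (divpow j)) i
        = (\<Sum>d\<in>?S. poly (Q d) (of_nat j) * dcoeff (f (divpow (nat (int j + d)))) i)"
      using j by (simp add: M(2) poly_End_sum[OF fe] poly_End_smult[OF fe] dcoeff_sum)
    also have "\<dots> = (\<Sum>d\<in>?S. poly (P (int i - int j - d)) (of_int d + of_nat j) * poly (Q d) (of_nat j))"
    proof (intro sum.cong refl)
      fix d assume d: "d \<in> ?S"
      have "int i - int (nat (int j + d)) = int i - int j - d" using M(1)[of j d] d j by simp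
      then show "poly (Q d) (of_nat j) * dcoeff (f (divpow (nat (int j + d)))) i
        = poly (P (int i - int j - d)) (of_int d + of_nat j) * poly (Q d) (of_nat j)"
        by (simp only: N[OF large[OF d]] cast[OF d] mult.commute)
    qed
    also have "\<dots> = poly (symbol_mult P Q (int i - int j)) (of_nat j)"
      by (simp add: symbol_mult_def poly_sum poly_pcompose)
    finally show ?thesis .
  qed
  then show ?thesis
    using fin' poly_End_comp[OF fe ge] unfolding has_symbol_def by blast
qed

definition monomial_symbol :: "'a::field_char_0 poly \<Rightarrow> int \<Rightarrow> int \<Rightarrow> 'a poly" where
  "monomial_symbol p k d = (if d = k then p else 0)"

lemma has_monomial_symbol:
  assumes "f \<in> poly_End"
    and "\<And>j. j \<ge> N \<Longrightarrow> 0 \<le> int j + k \<and> f (divpow j) = smult (poly p (of_nat j)) (divpow (nat (int j + k)))"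
  shows "has_symbol f (monomial_symbol p k)"
proof -
  have "finite {d. monomial_symbol p k d \<noteq> 0}"
    by (rule finite_subset[of _ "{k}"]) (auto simp: monomial_symbol_def)
  moreover have "dcoeff (f (divpow j)) i = poly (monomial_symbol p k (int i - int j)) (of_nat j)"
    if "j \<ge> N" for i j
    using assms(2)[OF that] by (auto simp: monomial_symbol_def)
  ultimately show ?thesis
    using assms(1) unfolding has_symbol_def by blast
qed

lemma symbol_id: "has_symbol id (monomial_symbol 1 0)"
  by (rule has_monomial_symbol[OF poly_End_id, of 0]) simp

text \<open>The generators have one-term symbols, and symbols are stable under the operations of an
  algebra.\<close>

lemma symbol_ex: "f \<in> I1 \<Longrightarrow> \<exists>P. has_symbol f P"
  unfolding I1_def
proof (induction rule: gen_subalgebra.induct)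
  case (gen f)
  have "has_symbol mult_x (monomial_symbol [:1, 1:] 1)"
    by (rule has_monomial_symbol[OF mult_x_End, of 0]) (simp add: mult_x_divpow nat_add_distrib)
  moreover have "has_symbol pderiv (monomial_symbol 1 (- 1))"
    by (rule has_monomial_symbol[OF pderiv_End, of 1]) (auto simp: pderiv_divpow nat_diff_distrib)
  moreover have "has_symbol poly_integral (monomial_symbol 1 1)"
    by (rule has_monomial_symbol[OF integral_End, of 0]) (simp add: integral_divpow nat_add_distrib)
  ultimately show ?case using gen by blast
qed (use symbol_id symbol_plus symbol_scale symbol_comp in blast)+

section \<open>Nilpotency from a commutation relation\<close>

text \<open>The operator \<open>g(a)\<close> for a polynomial \<open>g\<close>, as an explicit sum because operators are plain
  functions.\<close>

definition opoly :: "('a::field_char_0 poly \<Rightarrow> 'a poly) \<Rightarrow> 'a poly \<Rightarrow> 'a poly \<Rightarrow> 'a poly" where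
  "opoly a g v = (\<Sum>k\<le>degree g. smult (coeff g k) ((a ^^ k) v))"

lemma opoly_bound:
  assumes "degree g < n"
  shows "opoly a g v = (\<Sum>k<n. smult (coeff g k) ((a ^^ k) v))"
  unfolding opoly_def
  by (rule sum.mono_neutral_left) (use assms in \<open>auto simp: coeff_eq_0\<close>)

lemma opoly_End:
  assumes "a \<in> poly_End"
  shows "opoly a g \<in> poly_End"
  by (rule poly_End_I)
    (simp_all add: opoly_def poly_End_add[OF poly_End_funpow[OF assms]] mult.commute
      poly_End_smult[OF poly_End_funpow[OF assms]] smult_add_right sum.distrib smult_sum_right)

lemma opoly_add: "opoly a (f + g) v = opoly a f v + opoly a g v"
proof -
  define n where "n = Suc (max (degree f) (degree g))"
  have "degree (f + g) < n" "degree f < n" "degree g < n"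
    using degree_add_le_max[of f g] by (auto simp: n_def)
  then show ?thesis
    by (simp only: opoly_bound[of _ n]) (simp add: smult_add_left sum.distrib)
qed

lemma opoly_smult: "opoly a (smult c f) v = smult c (opoly a f v)"
  using opoly_bound[of "smult c f" "Suc (degree f)" a v] opoly_bound[of f "Suc (degree f)" a v]
  by (simp add: smult_sum_right del: sum.lessThan_Suc)

lemma opoly_0 [simp]: "opoly a 0 v = 0"
  by (simp add: opoly_def)

lemma opoly_monom [simp]: "opoly a (monom c n) v = smult c ((a ^^ n) v)"
proof -
  have "opoly a (monom c n) v = (\<Sum>k<Suc n. if k = n then smult c ((a ^^ k) v) else 0)"
    unfolding opoly_bound[OF le_less_trans[OF degree_monom_le lessI]] by (intro sum.cong) auto
  then show ?thesis by simp
qed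

lemma opoly_pCons:
  assumes "a \<in> poly_End"
  shows "opoly a (pCons c g) v = smult c v + a (opoly a g v)"
proof -
  have "opoly a (pCons c g) v = (\<Sum>k<Suc (Suc (degree g)). smult (coeff (pCons c g) k) ((a ^^ k) v))"
    by (rule opoly_bound) (simp add: degree_pCons_le le_imp_less_Suc)
  also have "\<dots> = smult c v + (\<Sum>k<Suc (degree g). smult (coeff g k) (a ((a ^^ k) v)))"
    by (subst sum.lessThan_Suc_shift) simp
  also have "\<dots> = smult c v + a (opoly a g v)"
    by (simp only: opoly_bound[OF lessI] poly_End_sum[OF assms] poly_End_smult[OF assms])
  finally show ?thesis .
qed

lemma opoly_mult:
  assumes "a \<in> poly_End"
  shows "opoly a (f * g) v = opoly a f (opoly a g v)"
  by (induction f)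
    (simp_all add: opoly_pCons[OF assms] opoly_add opoly_smult)

lemma opoly_commute:
  assumes "a \<in> poly_End"
  shows "opoly a f (opoly a g v) = opoly a g (opoly a f v)"
  by (metis opoly_mult[OF assms] mult.commute)

text \<open>Each basis vector is annihilated by a nonzero polynomial in \<open>a\<close>, since its first \<open>n + 1\<close>
  iterates are dependent; the product of these polynomials annihilates everything.\<close>

lemma annihilator:
  assumes a: "a \<in> poly_End" and an: "\<And>p. p \<in> below n \<Longrightarrow> a p \<in> below n"
  shows "\<exists>g. g \<noteq> 0 \<and> (\<forall>p\<in>below n. opoly a g p = 0)"
proof -
  have one: "\<exists>g. g \<noteq> 0 \<and> opoly a g v = 0" if v: "v \<in> below n" for v
  proof -
    have av: "(a ^^ k) v \<in> below n" for k
      by (induction k) (use v an in auto)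
    have "combination (\<lambda>k. (a ^^ k) v) q \<in> below n" if "q \<in> below (Suc n)" for q
      by (rule poly_End_below[OF combination_End _ that]) (simp add: av)
    from exists_kernel[OF combination_End this lessI] obtain p
      where p: "p \<in> below (Suc n)" "p \<noteq> 0" "combination (\<lambda>k. (a ^^ k) v) p = 0" by blast
    define g where "g = (\<Sum>k<Suc n. monom (dcoeff p k) k)"
    have "opoly a g v = (\<Sum>k<m. opoly a (monom (dcoeff p k) k) v)" 
      if "g = (\<Sum>k<m. monom (dcoeff p k) k)" for m g
      unfolding that by (induction m) (simp_all add: opoly_add)
    from this[OF g_def] have "opoly a g v = 0"
      using p(3) by (simp add: combination_below[OF p(1)])
    moreover have "coeff g k = dcoeff p k" for k
      using below_D[OF p(1), of k] by (auto simp: g_def coeff_sum simp del: sum.lessThan_Suc)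
    then have "g \<noteq> 0"
      using p(2) by (metis coeff_0 dcoeff_simps(1) poly_eqI_dcoeff)
    ultimately show ?thesis by blast
  qed
  have "\<exists>g. g \<noteq> 0 \<and> (\<forall>i<m. opoly a g (divpow i) = 0)" if "m \<le> n" for m
    using that
  proof (induction m)
    case (Suc m)
    then obtain g where g: "g \<noteq> 0" "\<forall>i<m. opoly a g (divpow i) = 0" by auto
    obtain g' where g': "g' \<noteq> 0" "opoly a g' (divpow m) = 0"
      using one[OF divpow_below[of m n]] Suc.prems by auto
    have "opoly a (g * g') (divpow i) = 0" if "i < Suc m" for i
    proof (cases "i = m")
      case True
      then show ?thesis by (simp add: opoly_mult[OF a] g' poly_End_0[OF opoly_End[OF a]])
    next
      case False
      then show ?thesis
        using that g by (simp add: opoly_mult[OF a] opoly_commute[OF a, of g g']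
            poly_End_0[OF opoly_End[OF a]])
    qed
    moreover have "g * g' \<noteq> 0" using g g' by simp
    ultimately show ?case by blast
  qed (auto intro: exI[of _ 1])
  then obtain g where g: "g \<noteq> 0" "\<forall>i<n. opoly a g (divpow i) = 0" by blast
  have "opoly a g p = 0" if "p \<in> below n" for p
    unfolding poly_End_expansion[OF opoly_End[OF a] that] using g by simp
  with g show ?thesis by blast
qed

text \<open>The map \<open>f \<mapsto> f h - h f\<close> is a derivation that fixes \<open>a\<close>, so on polynomials in \<open>a\<close> it acts as
  \<open>X d/dX\<close>.\<close>

lemma opoly_commutator:
  assumes a: "a \<in> poly_End" and h: "h \<in> poly_End" and ha: "\<And>p. h (a p) = a (h p) - a p"
  shows "opoly a g (h p) - h (opoly a g p) = opoly a (pCons 0 (pderiv g)) p"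
proof -
  have pow: "(a ^^ k) (h p) - h ((a ^^ k) p) = smult (of_nat k) ((a ^^ k) p)" for k
  proof (induction k)
    case (Suc k)
    have "(a ^^ Suc k) (h p) - h ((a ^^ Suc k) p) = a ((a ^^ k) (h p) - h ((a ^^ k) p)) + (a ^^ Suc k) p"
      by (simp add: ha poly_End_diff[OF a])
    also have "\<dots> = smult (of_nat (Suc k)) ((a ^^ Suc k) p)"
      unfolding Suc by (simp add: poly_End_smult[OF a] smult_add_left)
    finally show ?case .
  qed simp
  have c: "coeff (pCons 0 (pderiv g)) k = of_nat k * coeff g k" for k
    by (cases k) (simp_all add: coeff_pderiv)
  have "degree (pCons 0 (pderiv g)) < Suc (degree g)"
    unfolding less_Suc_eq_le by (rule degree_le) (simp add: c coeff_eq_0)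
  from opoly_bound[OF this] have "opoly a (pCons 0 (pderiv g)) p
      = (\<Sum>k<Suc (degree g). smult (coeff g k) ((a ^^ k) (h p) - h ((a ^^ k) p)))"
    by (simp only: c pow smult_smult mult.commute)
  also have "\<dots> = opoly a g (h p) - h (opoly a g p)"
    by (simp only: opoly_bound[OF lessI] poly_End_sum[OF h] poly_End_smult[OF h]
        smult_diff_right sum_subtractf)
  finally show ?thesis ..
qed

text \<open>For a polynomial \<open>g\<close> of least degree that annihilates the space, \<open>X g' - (deg g) g\<close>
  annihilates it as well and has smaller degree, so it is zero. In characteristic zero this
  leaves only multiples of \<open>X\<^sup>d\<close> for \<open>g\<close>.\<close>

lemma nilpotent_on_below:
  assumes a: "a \<in> poly_End" and h: "h \<in> poly_End" and ha: "\<And>p. h (a p) = a (h p) - a p"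
    and an: "\<And>p. p \<in> below n \<Longrightarrow> a p \<in> below n"
    and hn: "\<And>p. p \<in> below n \<Longrightarrow> h p \<in> below n"
  shows "\<exists>d. \<forall>p\<in>below n. (a ^^ d) p = 0"
proof -
  let ?A = "\<lambda>g. g \<noteq> 0 \<and> (\<forall>p\<in>below n. opoly a g p = 0)"
  obtain g where g: "?A g" and min: "\<And>g'. ?A g' \<Longrightarrow> degree g \<le> degree g'"
    using exists_least_iff[of "\<lambda>d. \<exists>g. ?A g \<and> degree g = d"] annihilator[OF a an]
    by (metis not_less)
  define d where "d = degree g"
  define r where "r = pCons 0 (pderiv g) + smult (- of_nat d) g"
  have c: "coeff r k = (of_nat k - of_nat d) * coeff g k" for k
    by (cases k) (simp_all add: r_def coeff_pderiv algebra_simps)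
  have r0: "opoly a r p = 0" if p: "p \<in> below n" for p
    unfolding r_def opoly_add opoly_smult opoly_commutator[OF a h ha, symmetric]
    using g p hn[OF p] by (simp add: poly_End_0[OF h])
  have "r = 0"
  proof (rule ccontr)
    assume "r \<noteq> 0"
    then have "d \<le> degree r" using min r0 by (simp add: d_def)
    moreover have "coeff r k = 0" if "k \<ge> d" for k
      using that by (cases "k = d") (auto simp: c d_def coeff_eq_0)
    ultimately show False using \<open>r \<noteq> 0\<close> by (metis leading_coeff_0_iff)
  qed
  then have "coeff g k = 0" if "k \<noteq> d" for k
    using c[of k] that by simp
  then have "g = monom (coeff g d) d" by (intro poly_eqI) simp
  moreover have "coeff g d \<noteq> 0" using g by (simp add: d_def)
  ultimately show ?thesis
    using g by (metis opoly_monom smult_eq_0_iff)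
qed

section \<open>Symbol calculus\<close>

lemma monomial_symbol_simps [simp]:
  "monomial_symbol p k k = p" "d \<noteq> k \<Longrightarrow> monomial_symbol p k d = 0"
  by (simp_all add: monomial_symbol_def)

lemma symbol_mult_single:
  assumes "finite {e. Q e \<noteq> 0}" "\<And>e. e \<noteq> q \<Longrightarrow> Q e \<noteq> 0 \<Longrightarrow> P (d - e) = 0"
  shows "symbol_mult P Q d = pcompose (P (d - q)) [:of_int q, 1:] * Q q"
proof -
  have "symbol_mult P Q d = (\<Sum>e | Q e \<noteq> 0. if e = q then pcompose (P (d - q)) [:of_int q, 1:] * Q q else 0)"
    unfolding symbol_mult_def using assms(2) by (intro sum.cong) auto
  then show ?thesis using assms(1) by (cases "Q q = 0") auto
qed

lemma pcompose_shift_eq_0_iff: "pcompose p [:c, 1:] = 0 \<longleftrightarrow> p = (0 :: 'a::field_char_0 poly)"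
  using pcompose_eq_0[of p "[:c, 1:]"] by auto

text \<open>Coefficients lie in a domain, so the top terms of \<open>P\<close> and \<open>Q\<close> multiply to the top term of
  the product, and likewise the bottom terms. As the product has a single term, so have both
  factors.\<close>

lemma symbol_mult_eq_one:
  fixes P Q :: "int \<Rightarrow> 'a::field_char_0 poly"
  assumes P: "finite {d. P d \<noteq> 0}" and Q: "finite {d. Q d \<noteq> 0}"
    and PQ: "symbol_mult P Q = monomial_symbol 1 0"
  obtains c i where "c \<noteq> 0" "P = monomial_symbol [:c:] (- i)" "Q = monomial_symbol [:1 / c:] i"
proof -
  let ?SP = "{d. P d \<noteq> 0}" and ?SQ = "{d. Q d \<noteq> 0}"
  have PQ0: "symbol_mult P Q 0 = 1" and PQd: "\<And>d. symbol_mult P Q d \<noteq> 0 \<Longrightarrow> d = 0"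
    unfolding PQ by (auto simp: monomial_symbol_def split: if_splits)
  have "\<exists>d. P d \<noteq> 0" "\<exists>d. Q d \<noteq> 0"
    by (rule ccontr, use PQ0 in \<open>simp add: symbol_mult_def\<close>)+
  then have ne: "?SQ \<noteq> {}" "?SP \<noteq> {}"
    by auto
  have max: "P (Max ?SP) \<noteq> 0" "Q (Max ?SQ) \<noteq> 0" "\<And>d. P d \<noteq> 0 \<Longrightarrow> d \<le> Max ?SP" "\<And>d. Q d \<noteq> 0 \<Longrightarrow> d \<le> Max ?SQ"
    using Max_in[OF P ne(2)] Max_in[OF Q ne(1)] Max_ge[OF P] Max_ge[OF Q] by auto
  have min: "P (Min ?SP) \<noteq> 0" "Q (Min ?SQ) \<noteq> 0" "\<And>d. P d \<noteq> 0 \<Longrightarrow> Min ?SP \<le> d" "\<And>d. Q d \<noteq> 0 \<Longrightarrow> Min ?SQ \<le> d"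
    using Min_in[OF P ne(2)] Min_in[OF Q ne(1)] Min_le[OF P] Min_le[OF Q] by auto
  have "symbol_mult P Q (Max ?SP + Max ?SQ) \<noteq> 0"
    using max by (subst symbol_mult_single[OF Q, of "Max ?SQ"])
      (force simp: pcompose_shift_eq_0_iff)+
  then have mx: "Max ?SP + Max ?SQ = 0" by (rule PQd)
  have "symbol_mult P Q (Min ?SP + Min ?SQ) \<noteq> 0"
    using min by (subst symbol_mult_single[OF Q, of "Min ?SQ"])
      (force simp: pcompose_shift_eq_0_iff)+
  then have mn: "Min ?SP + Min ?SQ = 0" by (rule PQd)
  define i where "i = Max ?SQ"
  have P1: "d = - i" if "P d \<noteq> 0" for d
    using max(3)[OF that] min(3)[OF that] max(4)[OF min(2)] mx mn by (simp add: i_def)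
  have Q1: "d = i" if "Q d \<noteq> 0" for d
    using max(4)[OF that] min(4)[OF that] max(3)[OF min(1)] mx mn by (simp add: i_def)
  have "pcompose (P (- i)) [:of_int i, 1:] * Q i = 1"
    using symbol_mult_single[OF Q, of i P 0] Q1 PQ0 by auto
  then have prod: "degree (pcompose (P (- i)) [:of_int i, 1:]) = 0" "degree (Q i) = 0"
    "pcompose (P (- i)) [:of_int i, 1:] * Q i = 1"
    using degree_mult_eq[of "pcompose (P (- i)) [:of_int i, 1:]" "Q i"] by force+
  then have "degree (P (- i)) = 0" by (simp add: degree_pcompose)
  then obtain c where c: "P (- i) = [:c:]" by (metis degree_0_id)
  obtain c' where c': "Q i = [:c':]" using prod(2) by (metis degree_0_id)
  have "c * c' = 1" using prod(3) by (simp add: c c' one_pCons mult.commute)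
  then have "c \<noteq> 0" by auto
  with \<open>c * c' = 1\<close> have "c' = 1 / c" by (simp add: eq_divide_eq mult.commute)
  with \<open>c \<noteq> 0\<close> show thesis
    using P1 Q1 c c' by (intro that[of c i]) (auto simp: monomial_symbol_def fun_eq_iff)
qed

text \<open>The polynomial takes the value \<open>p(0)\<close> at all multiples of \<open>c\<close>, which are infinitely many in
  characteristic zero.\<close>

lemma periodic_poly_const:
  fixes p :: "'a::field_char_0 poly"
  assumes "pcompose p [:c, 1:] = p" "c \<noteq> 0"
  obtains k where "p = [:k:]"
proof -
  have step: "poly p (c + x) = poly p x" for x
    using arg_cong[OF assms(1), of "\<lambda>q. poly q x"] by (simp add: poly_pcompose)
  have per: "poly p (of_nat n * c) = poly p 0" for n
    by (induction n) (simp_all add: distrib_right step)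
  \<comment> \<open>The substitution of \<open>c X\<close> for \<open>X\<close> turns multiples of \<open>c\<close> into natural numbers.\<close>
  have "pcompose p [:0, c:] = [:poly p 0:]"
    by (rule poly_eqI_of_nat[of 0]) (simp add: poly_pcompose per)
  then have "degree p = 0"
    using assms(2) degree_pcompose[of p "[:0, c:]"] by simp
  then show thesis using that by (metis degree_0_id)
qed

lemma symbol_below:
  assumes f: "has_symbol f P" and s: "\<forall>d>s. P d = 0"
  obtains M where "\<And>n. n \<ge> M \<Longrightarrow> 0 \<le> int n + s"
    and "\<And>n p. n \<ge> M \<Longrightarrow> p \<in> below n \<Longrightarrow> f p \<in> below (nat (int n + s))"
proof -
  have fe: "f \<in> poly_End" using f by (simp add: has_symbol_def)
  obtain N where N: "\<And>j i. j \<ge> N \<Longrightarrow> dcoeff (f (divpow j)) i = poly (P (int i - int j)) (of_nat j)"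
    using f by (auto simp: has_symbol_def)
  obtain m where m: "\<forall>j<N. f (divpow j) \<in> below m"
    using finite_ex_below[of N "\<lambda>j. f (divpow j)"] by blast
  define M where "M = N + m + nat \<bar>s\<bar>"
  have M: "0 \<le> int n + s" "m \<le> nat (int n + s)" if "n \<ge> M" for n
    using that by (auto simp: M_def)
  have "f p \<in> below (nat (int n + s))" if n: "n \<ge> M" and p: "p \<in> below n" for n p
  proof (rule poly_End_below[OF fe _ p])
    fix j assume j: "j < n"
    show "f (divpow j) \<in> below (nat (int n + s))"
    proof (cases "j < N")
      case True
      then show ?thesis using m M(2)[OF n] by (blast intro: below_mono)
    next
      case False
      show ?thesis
      proof (rule below_I)
        fix i assume "i \<ge> nat (int n + s)"
        then have "int i - int j > s" using j by linarith
        then show "dcoeff (f (divpow j)) i = 0" using False N s by simp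
      qed
    qed
  qed
  with M(1) show thesis by (rule that)
qed

lemma symbol_leading:
  assumes f: "has_symbol f P" and s: "\<forall>d>s. P d = 0"
  obtains M where "\<And>n. n \<ge> M \<Longrightarrow> 0 \<le> int n + s"
    and "\<And>n p. n \<ge> M \<Longrightarrow> p \<in> below (Suc n) \<Longrightarrow>
      dcoeff (f p) (nat (int n + s)) = poly (P s) (of_nat n) * dcoeff p n"
proof -
  have fe: "f \<in> poly_End" using f by (simp add: has_symbol_def)
  obtain N where N: "\<And>j i. j \<ge> N \<Longrightarrow> dcoeff (f (divpow j)) i = poly (P (int i - int j)) (of_nat j)"
    using f by (auto simp: has_symbol_def)
  obtain M where M: "\<And>n. n \<ge> M \<Longrightarrow> 0 \<le> int n + s"
    "\<And>n p. n \<ge> M \<Longrightarrow> p \<in> below n \<Longrightarrow> f p \<in> below (nat (int n + s))"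
    by (rule symbol_below[OF f s]) (rule that)
  show thesis
  proof (rule that[of "max M N"])
    fix n and p :: "'a poly" assume n: "n \<ge> max M N" and p: "p \<in> below (Suc n)"
    define q where "q = p - smult (dcoeff p n) (divpow n)"
    have "q \<in> below n"
      using p by (auto simp: q_def below_def)
    then have "dcoeff (f q) (nat (int n + s)) = 0"
      using M(2)[of n q] n by (auto intro: below_D)
    moreover have "f p = f q + smult (dcoeff p n) (f (divpow n))"
      by (simp add: q_def poly_End_diff[OF fe] poly_End_smult[OF fe])
    moreover have "int (nat (int n + s)) - int n = s" using M(1)[of n] n by simp
    ultimately show "dcoeff (f p) (nat (int n + s)) = poly (P s) (of_nat n) * dcoeff p n"
      using N[of n "nat (int n + s)"] n by simp
  qed (use M in simp)
qed

text \<open>The relations satisfied by the images of \<open>pderiv\<close>, \<open>poly_integral\<close> and \<open>euler\<close> under an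
  endomorphism.\<close>

locale deformed_triple =
  fixes a b h :: "'a::field_char_0 poly \<Rightarrow> 'a poly"
  assumes aE: "a \<in> poly_End" and bE: "b \<in> poly_End" and hE: "h \<in> poly_End"
    and ab: "a (b p) = p"
    and ha: "h (a p) = a (h p) - a p"
    and hb: "h (b p) = b (h p) + b p"
    and h_ker: "a p = 0 \<Longrightarrow> h p = p"
begin

lemma b_inj: "b p = 0 \<Longrightarrow> p = 0"
  using ab[of p] by (simp add: poly_End_0[OF aE])

lemma b_pow_inj: "(b ^^ n) p = 0 \<Longrightarrow> p = 0"
  by (induction n) (auto dest: b_inj)

lemma h_b_pow:
  assumes "a u = 0"
  shows "h ((b ^^ n) u) = smult (of_nat (Suc n)) ((b ^^ n) u)"
proof (induction n)
  case (Suc n)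
  have "h ((b ^^ Suc n) u) = smult (of_nat (Suc n)) ((b ^^ Suc n) u) + (b ^^ Suc n) u"
    by (simp only: funpow.simps o_apply hb Suc poly_End_smult[OF bE])
  then show ?case
    by (simp only: of_nat_Suc[of "Suc n"] smult_add_left smult_1_left add.commute)
qed (simp add: h_ker[OF assms])

text \<open>Guarantees that, for a suitable \<open>n\<close>, every nonzero eigenvector to the eigenvalue \<open>n + 1\<close> has
  large degree, so that the symbol of \<open>h\<close> governs its leading term.\<close>

lemma eigenvalue_avoiding_below:
  obtains n where "\<And>w. w \<in> below M \<Longrightarrow> h w = smult (of_nat (Suc n)) w \<Longrightarrow> w = 0"
proof -
  let ?E = "{e::nat. \<exists>w\<in>below M. w \<noteq> 0 \<and> h w = smult (of_nat e) w}"
  obtain m where m: "\<forall>e\<in>?E. e \<le> m"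
    using finite_eigenvalues[OF hE, of M] finite_nat_set_iff_bounded_le by blast
  show thesis
  proof (rule that[of m])
    fix w assume "w \<in> below M" "h w = smult (of_nat (Suc m)) w"
    then show "w = 0" using m by (metis (mono_tags, lifting) mem_Collect_eq not_less_eq_eq order_refl)
  qed
qed

end

section \<open>The leading behaviour of a deformed triple\<close>

context deformed_triple
begin

text \<open>Two vectors of the kernel yield, by \<open>b\<^sup>n\<close>, eigenvectors of \<open>h\<close> to the same eigenvalue. In
  large degree \<open>m\<close> the eigenvalue \<open>c + m r\<close> determines \<open>m\<close>, so both have the same degree; the
  combination that cancels the leading terms is an eigenvector of smaller degree, hence zero.\<close>

lemma kernel_is_line:
  assumes Hs: "has_symbol h Hs" "\<forall>d>0. Hs d = 0" "Hs 0 = [:c, r:]" and r: "r \<noteq> 0"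
    and u: "u \<noteq> 0" "a u = 0" and p: "a p = 0"
  obtains k where "p = smult k u"
proof (cases "p = 0")
  case True
  then show thesis using that[of 0] by simp
next
  case False
  obtain M where M: "\<And>n q. n \<ge> M \<Longrightarrow> q \<in> below (Suc n) \<Longrightarrow>
      dcoeff (h q) n = (c + of_nat n * r) * dcoeff q n"
    by (rule symbol_leading[OF Hs(1,2)], rule that) (simp add: Hs(3))
  obtain n where n: "\<And>w. w \<in> below M \<Longrightarrow> h w = smult (of_nat (Suc n)) w \<Longrightarrow> w = 0"
    by (rule eigenvalue_avoiding_below[of M]) (rule that)
  have top: "m \<ge> M \<and> c + of_nat m * r = of_nat (Suc n)"
    if w: "h w = smult (of_nat (Suc n)) w" "w \<in> below (Suc m)" "dcoeff w m \<noteq> 0" for w m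
  proof -
    have "w \<noteq> 0" using w(3) by auto
    then have "w \<notin> below M" using n w(1) by blast
    then have "m \<ge> M" using w(2) by (meson below_mono not_less_eq_eq)
    with M[OF this w(2)] w show ?thesis by simp
  qed
  let ?v = "(b ^^ n) u" and ?w = "(b ^^ n) p"
  have ev: "h ?v = smult (of_nat (Suc n)) ?v" "h ?w = smult (of_nat (Suc n)) ?w"
    using h_b_pow u(2) p by blast+
  have nz: "?v \<noteq> 0" "?w \<noteq> 0" using b_pow_inj u(1) False by blast+
  obtain m where m: "dcoeff ?v m \<noteq> 0" "?v \<in> below (Suc m)" using nonzero_top[OF nz(1)] .
  obtain m' where m': "dcoeff ?w m' \<noteq> 0" "?w \<in> below (Suc m')" using nonzero_top[OF nz(2)] .
  have eqn: "c + of_nat m * r = of_nat (Suc n)" "c + of_nat m' * r = of_nat (Suc n)"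
    using top[OF ev(1) m(2,1)] top[OF ev(2) m'(2,1)] by auto
  have "of_nat m * r = of_nat m' * r"
    using eqn by (metis add_left_cancel)
  then have [simp]: "m' = m" using r by simp
  \<comment> \<open>The leading terms of the eigenvectors cancel in the image of \<open>q\<close> under the power of \<open>b\<close>.\<close>
  define q where "q = smult (dcoeff ?v m) p - smult (dcoeff ?w m) u"
  have "q = 0"
  proof (rule ccontr)
    assume q: "q \<noteq> 0"
    let ?z = "(b ^^ n) q"
    have aq: "a q = 0" by (simp add: q_def poly_End_diff[OF aE] poly_End_smult[OF aE] p u(2))
    have "?z \<noteq> 0" using b_pow_inj q by blast
    then obtain l where l: "dcoeff ?z l \<noteq> 0" "?z \<in> below (Suc l)" by (rule nonzero_top)
    have "c + of_nat l * r = of_nat (Suc n)" using top[OF h_b_pow[OF aq] l(2,1)] by simp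
    then have "of_nat m * r = of_nat l * r" using eqn(1) by (metis add_left_cancel)
    then have "l = m" using r by simp
    moreover have "?z = smult (dcoeff ?v m) ?w - smult (dcoeff ?w m) ?v"
      by (simp add: q_def poly_End_diff[OF poly_End_funpow[OF bE]] poly_End_smult[OF poly_End_funpow[OF bE]])
    then have "dcoeff ?z m = 0" by simp
    ultimately show False using l(1) by simp
  qed
  then have "smult (1 / dcoeff ?v m) (smult (dcoeff ?v m) p)
      = smult (1 / dcoeff ?v m) (smult (dcoeff ?w m) u)"
    by (simp add: q_def)
  then have "p = smult (1 / dcoeff ?v m * dcoeff ?w m) u" using m(1) by simp
  then show thesis by (rule that)
qed

text \<open>The relation \<open>h a = a h - a\<close> reads \<open>P\<^sub>e(j - i) = P\<^sub>e(j) - [e = 0]\<close> for the components of the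
  symbol of \<open>h\<close>. So those with \<open>e \<noteq> 0\<close> are periodic, as is \<open>P\<^sub>0(j) - j/i\<close>, while \<open>i = 0\<close> is
  impossible.\<close>

lemma symbol_of_h:
  assumes A: "has_symbol a (monomial_symbol [:l:] (- i))" and "l \<noteq> 0" and Hs: "has_symbol h Hs"
  shows "i \<noteq> 0" and "\<And>d. d \<noteq> 0 \<Longrightarrow> \<exists>k. Hs d = [:k:]" and "\<exists>c. Hs 0 = [:c, 1 / of_int i:]"
proof -
  let ?A = "monomial_symbol [:l:] (- i)"
  have fin: "finite {d. Hs d \<noteq> 0}" "finite {d. ?A d \<noteq> 0}"
    using Hs A by (simp_all add: has_symbol_def)
  have "h \<circ> a = (\<lambda>p. (a \<circ> h) p + smult (- 1) (a p))"
    by (simp add: fun_eq_iff ha)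
  then have "has_symbol (h \<circ> a) (\<lambda>d. symbol_mult ?A Hs d + smult (- 1) (?A d))"
    using symbol_plus[OF symbol_comp[OF A Hs] symbol_scale[OF A, of "- 1"]] by simp
  from symbol_unique[OF symbol_comp[OF Hs A] this]
  have eq: "symbol_mult Hs ?A d = symbol_mult ?A Hs d + smult (- 1) (?A d)" for d
    by (simp add: fun_eq_iff)
  have shift: "pcompose (Hs e) [:- of_int i, 1:] = Hs e - (if e = 0 then 1 else 0)" for e
  proof -
    have "symbol_mult Hs ?A (e - i) = pcompose (Hs e) [:- of_int i, 1:] * [:l:]"
      by (subst symbol_mult_single[OF fin(2), of "- i"]) (auto simp: monomial_symbol_def)
    moreover have "symbol_mult ?A Hs (e - i) = [:l:] * Hs e"
      by (subst symbol_mult_single[OF fin(1), of e]) (auto simp: monomial_symbol_def)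
    ultimately have "[:l:] * pcompose (Hs e) [:- of_int i, 1:]
        = [:l:] * (Hs e - (if e = 0 then 1 else 0))"
      using eq[of "e - i"] by (auto simp: monomial_symbol_def smult_diff_right one_pCons)
    then show ?thesis using \<open>l \<noteq> 0\<close> by (metis mult_left_cancel pCons_eq_0_iff)
  qed
  show i: "i \<noteq> 0"
    using shift[of 0] by auto
  show "\<exists>k. Hs d = [:k:]" if "d \<noteq> 0" for d
    using periodic_poly_const[of "Hs d" "- of_int i"] shift[of d] that i by auto
  have "pcompose (Hs 0 - [:0, 1 / of_int i:]) [:- of_int i, 1:] = Hs 0 - [:0, 1 / of_int i:]"
    using shift[of 0] i by (simp add: pcompose_diff pcompose_pCons one_pCons)
  then obtain k where "Hs 0 - [:0, 1 / of_int i:] = [:k:]"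
    using periodic_poly_const[of "Hs 0 - [:0, 1 / of_int i:]" "- of_int i"] i by auto
  then have "Hs 0 = [:k, 1 / of_int i:]"
    by (metis add_pCons add.left_neutral add.right_neutral diff_add_cancel)
  then show "\<exists>c. Hs 0 = [:c, 1 / of_int i:]" by blast
qed

text \<open>A degree-raising leading term of \<open>h\<close> would leave no eigenvectors of large degree, but the
  \<open>b\<^sup>n u\<close> belong to infinitely many eigenvalues.\<close>

lemma symbol_of_h_pos:
  assumes Hs: "has_symbol h Hs" and const: "\<And>d. d \<noteq> 0 \<Longrightarrow> \<exists>k. Hs d = [:k:]"
    and u: "u \<noteq> 0" "a u = 0"
  shows "\<forall>d>0. Hs d = 0"
proof (rule ccontr)
  assume "\<not> ?thesis"
  then obtain d where d: "d > 0" "Hs d \<noteq> 0" by blast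
  have fin: "finite {d. Hs d \<noteq> 0}" using Hs by (simp add: has_symbol_def)
  define s where "s = Max {d. Hs d \<noteq> 0}"
  have s: "Hs s \<noteq> 0" "\<forall>d>s. Hs d = 0"
    using Max_in[OF fin] Max_ge[OF fin] d(2) by (auto simp: s_def) (meson not_less)
  have "s > 0" using s(2) d by (meson linorder_not_less order_less_le_trans)
  obtain k where k: "Hs s = [:k:]" "k \<noteq> 0" using const[of s] s(1) \<open>s > 0\<close> by auto
  obtain M where M: "\<And>n q. n \<ge> M \<Longrightarrow> q \<in> below (Suc n) \<Longrightarrow>
      dcoeff (h q) (nat (int n + s)) = k * dcoeff q n"
    by (rule symbol_leading[OF Hs s(2)], rule that) (simp add: k)
  obtain n where n: "\<And>w. w \<in> below M \<Longrightarrow> h w = smult (of_nat (Suc n)) w \<Longrightarrow> w = 0"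
    by (rule eigenvalue_avoiding_below[of M]) (rule that)
  let ?v = "(b ^^ n) u"
  have ev: "h ?v = smult (of_nat (Suc n)) ?v" by (rule h_b_pow[OF u(2)])
  have nz: "?v \<noteq> 0" using b_pow_inj u(1) by blast
  then obtain m where m: "dcoeff ?v m \<noteq> 0" "?v \<in> below (Suc m)" by (rule nonzero_top)
  have "m \<ge> M" using n[OF _ ev] nz m(2) by (meson below_mono not_less_eq_eq)
  then have "dcoeff (h ?v) (nat (int m + s)) \<noteq> 0" using M[OF _ m(2)] k(2) m(1) by simp
  moreover have "dcoeff ?v (nat (int m + s)) = 0"
    using \<open>s > 0\<close> by (intro below_D[OF m(2)]) linarith
  ultimately show False by (simp add: ev del: of_nat_Suc)
qed

end

locale I1_triple = deformed_triple +
  assumes aI: "a \<in> I1" and bI: "b \<in> I1" and hI: "h \<in> I1"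
begin

text \<open>The exponent \<open>i\<close> of the symbols is positive because \<open>b\<close> is injective, and it is \<open>1\<close> because
  an operator lowering degrees by \<open>i\<close> has a kernel of dimension at least \<open>i\<close>, whereas the kernel
  of \<open>a\<close> is a line.\<close>

lemma symbols_of_triple:
  obtains l Hs c u where "l \<noteq> 0" "has_symbol a (monomial_symbol [:l:] (- 1))"
    "has_symbol b (monomial_symbol [:1 / l:] 1)" "has_symbol h Hs"
    "\<forall>d>0. Hs d = 0" "Hs 0 = [:c, 1:]" "\<And>d. d \<noteq> 0 \<Longrightarrow> \<exists>k. Hs d = [:k:]"
    "u \<noteq> 0" "a u = 0" "\<And>p. a p = 0 \<Longrightarrow> \<exists>k. p = smult k u"
proof -
  obtain A B Hs where sym: "has_symbol a A" "has_symbol b B" "has_symbol h Hs"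
    using symbol_ex aI bI hI by metis
  have "a \<circ> b = id" by (simp add: fun_eq_iff ab)
  then have "symbol_mult A B = monomial_symbol 1 0"
    using symbol_unique[OF symbol_comp[OF sym(1,2)]] symbol_id by metis
  moreover have "finite {d. A d \<noteq> 0}" "finite {d. B d \<noteq> 0}"
    using sym by (simp_all add: has_symbol_def)
  ultimately obtain l i where l: "l \<noteq> 0"
    and A: "A = monomial_symbol [:l:] (- i)" and B: "B = monomial_symbol [:1 / l:] i"
    using symbol_mult_eq_one by metis
  note symA = sym(1)[unfolded A] and symB = sym(2)[unfolded B]
  note hs = symbol_of_h[OF symA l sym(3)]
  obtain c where c: "Hs 0 = [:c, 1 / of_int i:]" using hs(3) by blast
  have below_i: "\<forall>d>i. monomial_symbol [:1 / l:] i d = 0" and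
    below_mi: "\<forall>d>-i. monomial_symbol [:l:] (- i) d = 0"
    by (simp_all add: monomial_symbol_def)
  have "\<not> i < 0"
  proof
    assume i: "i < 0"
    obtain M where M: "\<And>n. n \<ge> M \<Longrightarrow> 0 \<le> int n + i"
      "\<And>n p. n \<ge> M \<Longrightarrow> p \<in> below n \<Longrightarrow> b p \<in> below (nat (int n + i))"
      by (rule symbol_below[OF symB below_i]) (rule that)
    have "nat (int M + i) < M" using M(1)[of M] i by simp
    from exists_kernel[OF bE M(2)[OF order_refl] this] show False using b_inj by blast
  qed
  then have i: "i > 0" using hs(1) by simp
  obtain M where M: "\<And>n. n \<ge> M \<Longrightarrow> 0 \<le> int n - i"
    "\<And>n p. n \<ge> M \<Longrightarrow> p \<in> below n \<Longrightarrow> a p \<in> below (nat (int n - i))"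
    by (rule symbol_below[OF symA below_mi], rule that) auto
  have lt: "nat (int M - i) < M" using M(1)[of M] i by simp
  obtain u where u: "u \<noteq> 0" "a u = 0"
    using exists_kernel[OF aE M(2)[OF order_refl] lt] by blast
  note pos = symbol_of_h_pos[OF sym(3) hs(2) u]
  have ker: "\<exists>k. p = smult k u" if "a p = 0" for p
    using kernel_is_line[OF sym(3) pos c _ u that] i by auto
  have "i = 1"
  proof (rule ccontr)
    assume "i \<noteq> 1"
    obtain t where t: "dcoeff u t \<noteq> 0" using nonzero_top[OF u(1)] by blast
    define n where "n = nat (int M - i)"
    \<comment> \<open>Adding a functional that detects \<open>u\<close> makes \<open>f\<close> injective; it maps into dimension
      \<open>M - i + 1\<close>, which is less than \<open>M\<close> if \<open>i > 1\<close>.\<close>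
    define f where "f = (\<lambda>p. a p + smult (dcoeff p t) (divpow n))"
    have fE: "f \<in> poly_End" unfolding f_def by (intro poly_End_plus aE dcoeff_End)
    have an: "a p \<in> below n" if "p \<in> below M" for p
      using M(2)[OF order_refl that] by (simp add: n_def)
    have "f p \<in> below (Suc n)" if "p \<in> below M" for p
      unfolding f_def using below_mono[OF an[OF that], of "Suc n"]
      by (intro below_closed divpow_below) auto
    moreover have "Suc n < M" using M(1)[of M] i \<open>i \<noteq> 1\<close> by (simp add: n_def)
    ultimately obtain p where p: "p \<in> below M" "p \<noteq> 0" "f p = 0"
      using exists_kernel[OF fE] by blast
    have "dcoeff (f p) n = dcoeff p t"
      using below_D[OF an[OF p(1)]] by (simp add: f_def)
    then have pt: "dcoeff p t = 0" using p(3) by simp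
    then have "a p = 0" using p(3) by (simp add: f_def)
    then obtain k where "p = smult k u" using ker by blast
    then show False using p(2) pt t by auto
  qed
  then show thesis
    using that[OF l symA[unfolded \<open>i = 1\<close>] symB[unfolded \<open>i = 1\<close>] sym(3) pos _ hs(2) u ker] c by simp
qed

lemma locally_nilpotent: "\<exists>d. (a ^^ d) p = 0"
proof -
  obtain l Hs where s: "has_symbol a (monomial_symbol [:l:] (- 1))" "has_symbol h Hs" "\<forall>d>0. Hs d = 0"
    using symbols_of_triple by metis
  have "\<forall>d>-1. monomial_symbol [:l:] (- 1) d = 0" by simp
  then obtain M where M: "\<And>n q. n \<ge> M \<Longrightarrow> q \<in> below n \<Longrightarrow> a q \<in> below (nat (int n - 1))"
    using symbol_below[OF s(1)] by (metis uminus_add_conv_diff add.commute)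
  obtain M' where M': "\<And>n q. n \<ge> M' \<Longrightarrow> q \<in> below n \<Longrightarrow> h q \<in> below n"
    by (rule symbol_below[OF s(2,3)], rule that) simp
  obtain m where "p \<in> below m" using ex_below by blast
  \<comment> \<open>From \<open>n\<close> on, both \<open>a\<close> and \<open>h\<close> preserve \<open>below n\<close>.\<close>
  define n where "n = max m (max M M')"
  have p: "p \<in> below n" using \<open>p \<in> below m\<close> by (rule below_mono) (simp add: n_def)
  have "a q \<in> below n" if "q \<in> below n" for q
    by (rule below_mono[OF M[OF _ that]]) (auto simp: n_def)
  moreover have "h q \<in> below n" if "q \<in> below n" for q
    by (rule M'[OF _ that]) (auto simp: n_def)
  ultimately show ?thesis
    using nilpotent_on_below[OF aE hE ha] p by meson
qed

end

section \<open>Transport of structure along an orbit\<close>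

text \<open>The operator \<open>x d + 1\<close>, diagonal in the basis \<open>divpow\<close> with the simple eigenvalues \<open>n + 1\<close>.\<close>

definition euler :: "'a::field_char_0 poly \<Rightarrow> 'a poly" where
  "euler = pderiv \<circ> mult_x"

lemma euler_divpow: "euler (divpow n) = smult (of_nat (Suc n)) (divpow n)"
  by (simp add: euler_def mult_x_divpow pderiv_smult pderiv_divpow del: of_nat_Suc)

lemma euler_I1: "euler \<in> I1"
  unfolding euler_def by (intro I1_closed)

lemma mult_x_eq: "mult_x = poly_integral \<circ> euler"
proof (rule poly_End_eqI)
  fix n
  show "mult_x (divpow n) = (poly_integral \<circ> euler) (divpow n)"
    by (simp add: mult_x_divpow euler_divpow poly_End_smult[OF integral_End] integral_divpow del: of_nat_Suc)
qed (simp_all add: mult_x_End poly_End_comp integral_End I1_End[OF euler_I1])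

lemma dcoeff_integral: "dcoeff (poly_integral p) (Suc i) = dcoeff p i"
  by (simp add: dcoeff_def coeff_poly_integral del: of_nat_Suc)

context deformed_triple
begin

text \<open>Injectivity: if \<open>n\<close> is the degree of \<open>p\<close>, applying \<open>a\<^sup>n\<close> to \<open>\<phi> p\<close> gives a nonzero multiple of
  \<open>u\<close>. Surjectivity: by induction on the power of \<open>a\<close> that kills \<open>p\<close>, as a preimage of \<open>a p\<close> can
  be integrated and corrected by a constant.\<close>

lemma intertwining_orbit_map:
  assumes u: "u \<noteq> 0" "a u = 0" and ker: "\<And>p. a p = 0 \<Longrightarrow> \<exists>k. p = smult k u"
    and nil: "\<And>p. \<exists>d. (a ^^ d) p = 0"
  defines "\<phi> \<equiv> combination (\<lambda>n. (b ^^ n) u)"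
  shows "\<phi> \<circ> poly_integral = b \<circ> \<phi>" and "\<phi> \<circ> pderiv = a \<circ> \<phi>" and "\<phi> \<circ> euler = h \<circ> \<phi>" and "bij \<phi>"
proof -
  have E: "\<phi> \<in> poly_End" by (simp add: \<phi>_def combination_End)
  have X: "\<phi> (divpow n) = (b ^^ n) u" for n by (simp add: \<phi>_def)
  show int: "\<phi> \<circ> poly_integral = b \<circ> \<phi>"
    by (rule poly_End_eqI) (simp_all add: poly_End_comp E integral_End bE integral_divpow X)
  show der: "\<phi> \<circ> pderiv = a \<circ> \<phi>"
  proof (rule poly_End_eqI)
    fix n
    show "(\<phi> \<circ> pderiv) (divpow n) = (a \<circ> \<phi>) (divpow n)"
      by (cases n) (simp_all add: pderiv_divpow X u ab poly_End_0[OF E])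
  qed (simp_all add: poly_End_comp E pderiv_End aE)
  show "\<phi> \<circ> euler = h \<circ> \<phi>"
  proof (rule poly_End_eqI)
    fix n
    show "(\<phi> \<circ> euler) (divpow n) = (h \<circ> \<phi>) (divpow n)"
      by (simp only: o_apply euler_divpow poly_End_smult[OF E] X h_b_pow[OF u(2)])
  qed (simp_all add: poly_End_comp E I1_End[OF euler_I1] hE)
  have pow: "\<phi> ((pderiv ^^ n) p) = (a ^^ n) (\<phi> p)" for n p
  proof (induction n)
    case (Suc n)
    then show ?case using fun_cong[OF der, of "(pderiv ^^ n) p"] by simp
  qed simp
  have inj: "p = 0" if "\<phi> p = 0" for p
  proof (rule ccontr)
    assume "p \<noteq> 0"
    then obtain n where n: "dcoeff p n \<noteq> 0" "p \<in> below (Suc n)" by (rule nonzero_top)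
    have "(pderiv ^^ n) p = (\<Sum>i<Suc n. if i = n then smult (dcoeff p n) (divpow 0) else 0)"
      unfolding poly_End_expansion[OF poly_End_funpow[OF pderiv_End] n(2)]
      by (intro sum.cong) (auto simp: pderiv_funpow_divpow)
    then have "(pderiv ^^ n) p = smult (dcoeff p n) (divpow 0)" by simp
    then have "smult (dcoeff p n) u = (a ^^ n) (\<phi> p)"
      unfolding pow[symmetric] by (simp add: poly_End_smult[OF E] X)
    then show False using n(1) u(1) that by (simp add: poly_End_0[OF poly_End_funpow[OF aE]])
  qed
  have "p \<in> range \<phi>" if "(a ^^ d) p = 0" for d p
    using that
  proof (induction d arbitrary: p)
    case 0
    then show ?case using poly_End_0[OF E] by (metis funpow_0 rangeI)
  next
    case (Suc d)
    then have "a p \<in> range \<phi>" by (simp add: funpow_swap1)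
    then obtain q where q: "a p = \<phi> q" by auto
    have iq: "\<phi> (poly_integral q) = b (\<phi> q)" using fun_cong[OF int, of q] by simp
    have "a (p - \<phi> (poly_integral q)) = 0"
      by (simp add: poly_End_diff[OF aE] iq ab q)
    then obtain k where "p - \<phi> (poly_integral q) = smult k u" using ker by blast
    then have "p = \<phi> (smult k (divpow 0) + poly_integral q)"
      by (simp add: poly_End_add[OF E] poly_End_smult[OF E] X diff_eq_eq)
    then show ?case by blast
  qed
  then have "surj \<phi>" using nil by blast
  moreover have "inj \<phi>"
  proof (rule injI)
    fix p q assume "\<phi> p = \<phi> q"
    then show "p = q" using inj[of "p - q"] by (simp add: poly_End_diff[OF E])
  qed
  ultimately show "bij \<phi>" by (simp add: bij_def)
qed

end

lemma bij_poly_End_inv: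
  assumes "f \<in> poly_End" "bij f"
  shows "inv f \<in> poly_End"
proof (rule poly_End_I)
  have s: "f (inv f p) = p" for p using assms(2) by (simp add: bij_is_surj surj_f_inv_f)
  have i: "inv f (f p) = p" for p using assms(2) by (simp add: bij_is_inj)
  show "inv f (p + q) = inv f p + inv f q" for p q
    using i[of "inv f p + inv f q"] by (simp add: poly_End_add[OF assms(1)] s)
  show "inv f (smult c p) = smult c (inv f p)" for c p
    using i[of "smult c (inv f p)"] by (simp add: poly_End_smult[OF assms(1)] s)
qed

lemma poly_End_sum_fun: "(\<And>k. k \<in> A \<Longrightarrow> f k \<in> poly_End) \<Longrightarrow> (\<lambda>p. \<Sum>k\<in>A. f k p) \<in> poly_End"
  by (rule poly_End_I) (simp_all add: poly_End_add poly_End_smult sum.distrib smult_sum_right)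

text \<open>Finitely many members of the orbit are dependent. Solving a dependency for its first term
  \<open>w k\<close> expresses it by a polynomial in \<open>B\<close> applied to \<open>w (k + 1)\<close>, and applying powers of \<open>B\<close>
  moves this relation along the orbit.\<close>

lemma orbit_reversible:
  assumes B: "B \<in> poly_End" and w: "\<And>j. w j \<in> below N" and step: "\<And>j. w (Suc j) = B (w j)"
  obtains B' k where "B' \<in> poly_End" "\<And>m. m \<ge> k \<Longrightarrow> w m = B' (w (Suc m))"
proof -
  have "combination w q \<in> below N" if "q \<in> below (Suc N)" for q
    by (rule poly_End_below[OF combination_End _ that]) (simp add: w)
  from exists_kernel[OF combination_End this lessI]
  obtain p where p: "p \<in> below (Suc N)" "p \<noteq> 0" "combination w p = 0" by blast
  define k where "k = (LEAST k. dcoeff p k \<noteq> 0)"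
  have "\<exists>k. dcoeff p k \<noteq> 0" using p(2) nonzero_top by metis
  then have k: "dcoeff p k \<noteq> 0" unfolding k_def by (rule LeastI_ex)
  have k0: "dcoeff p j = 0" if "j < k" for j
    using that not_less_Least unfolding k_def by blast
  have "k < Suc N" using k below_D[OF p(1)] by (meson not_less)
  have iter: "w (n + j) = (B ^^ n) (w j)" for n j
    by (induction n) (simp_all add: step)
  define B' where "B' = (\<lambda>q. \<Sum>j\<in>{Suc k..<Suc N}. smult (- dcoeff p j / dcoeff p k) ((B ^^ (j - Suc k)) q))"
  show thesis
  proof (rule that)
    show "B' \<in> poly_End"
      unfolding B'_def by (intro poly_End_sum_fun poly_End_scale poly_End_funpow B)
    fix m assume "m \<ge> k"
    then obtain n where m: "m = n + k" by (metis add.commute le_Suc_ex)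
    have "(B ^^ n) (combination w p) = 0"
      by (simp add: p(3) poly_End_0[OF poly_End_funpow[OF B]])
    then have "0 = (\<Sum>j<Suc N. smult (dcoeff p j) (w (n + j)))"
      unfolding combination_below[OF p(1)]
      by (simp only: poly_End_sum[OF poly_End_funpow[OF B]] poly_End_smult[OF poly_End_funpow[OF B]] iter)
    also have "\<dots> = (\<Sum>j\<in>{k..<Suc N}. smult (dcoeff p j) (w (n + j)))"
      by (rule sum.mono_neutral_right) (auto simp: k0 not_le)
    also have "\<dots> = smult (dcoeff p k) (w m) + (\<Sum>j\<in>{Suc k..<Suc N}. smult (dcoeff p j) (w (n + j)))"
      using \<open>k < Suc N\<close> by (subst sum.atLeast_Suc_lessThan) (simp_all only: m)
    finally have "smult (dcoeff p k) (w m) = - (\<Sum>j\<in>{Suc k..<Suc N}. smult (dcoeff p j) (w (n + j)))"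
      by (metis eq_neg_iff_add_eq_0)
    then have "smult (1 / dcoeff p k) (smult (dcoeff p k) (w m))
        = smult (1 / dcoeff p k) (- (\<Sum>j\<in>{Suc k..<Suc N}. smult (dcoeff p j) (w (n + j))))"
      by (rule arg_cong)
    then have "w m = (\<Sum>j\<in>{Suc k..<Suc N}. smult (- dcoeff p j / dcoeff p k) (w (n + j)))"
      using k by (simp add: smult_sum_right sum_negf[symmetric] del: sum.op_ivl_Suc)
    also have "\<dots> = B' (w (Suc m))"
      unfolding B'_def
    proof (intro sum.cong refl)
      fix j assume "j \<in> {Suc k..<Suc N}"
      then have "n + j = (j - Suc k) + Suc m" by (simp add: m)
      then show "smult (- dcoeff p j / dcoeff p k) (w (n + j))
        = smult (- dcoeff p j / dcoeff p k) ((B ^^ (j - Suc k)) (w (Suc m)))"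
        by (simp only: iter)
    qed
    finally show "w m = B' (w (Suc m))" .
  qed
qed

context I1_triple
begin

text \<open>Let \<open>v j = b\<^sup>j u\<close> and let \<open>w j\<close> be its part below \<open>N\<close>. As \<open>b\<close> is a shift from \<open>N\<close> on and differs
  from the integral only in coefficients below \<open>N\<close>, \<open>w (j + 1)\<close> depends linearly on \<open>w j\<close>, and
  coefficient \<open>N - 1 + n\<close> of \<open>v j\<close> is coefficient \<open>N - 1\<close> of \<open>w (j - n)\<close>. The part of \<open>h (v j)\<close>
  below \<open>N\<close> involves only \<open>w j\<close> and finitely many of these coefficients. Reversing the orbit
  expresses all of them through \<open>w j\<close>, so that \<open>w j\<close> is an eigenvector to \<open>j + 1\<close> of one fixed
  operator, or zero; the latter must happen for large \<open>j\<close>.\<close>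

lemma low_part_vanishes:
  assumes B: "has_symbol b (monomial_symbol 1 1)" and Hs: "has_symbol h Hs"
    and u: "a u = 0"
  obtains N J where "\<And>p. b p - poly_integral p \<in> below N" "\<And>j. j \<ge> N \<Longrightarrow> b (divpow j) = divpow (Suc j)"
    "\<And>i j. j \<ge> N \<Longrightarrow> dcoeff (h (divpow j)) i = poly (Hs (int i - int j)) (of_nat j)"
    "\<And>d. Hs d \<noteq> 0 \<Longrightarrow> \<bar>d\<bar> \<le> int N"
    "\<And>i. i < N \<Longrightarrow> dcoeff ((b ^^ J) u) i = 0"
proof -
  have fin: "finite {d. Hs d \<noteq> 0}" using Hs by (simp add: has_symbol_def)
  obtain d where d: "\<And>e. Hs e \<noteq> 0 \<Longrightarrow> \<bar>e\<bar> \<le> int d"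
    using finite_int_bound[OF fin] by (metis mem_Collect_eq)
  obtain N1 where N1: "\<And>i j. j \<ge> N1 \<Longrightarrow> dcoeff (h (divpow j)) i = poly (Hs (int i - int j)) (of_nat j)"
    using Hs by (auto simp: has_symbol_def)
  obtain N2 where N2: "\<And>i j. j \<ge> N2 \<Longrightarrow> dcoeff (b (divpow j)) i = poly (monomial_symbol 1 1 (int i - int j)) (of_nat j)"
    using B by (auto simp: has_symbol_def)
  have bX: "b (divpow j) = divpow (Suc j)" if "j \<ge> N2" for j
    by (rule poly_eqI_dcoeff) (auto simp: N2[OF that] monomial_symbol_def)
  define g where "g = (\<lambda>p. b p - poly_integral p)"
  have gE: "g \<in> poly_End"
    using poly_End_plus[OF bE poly_End_scale[OF integral_End, of "- 1"]] by (simp add: g_def)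
  obtain m where m: "\<forall>j<N2. g (divpow j) \<in> below m"
    using finite_ex_below[of N2 "\<lambda>j. g (divpow j)"] by blast
  \<comment> \<open>Beyond \<open>N\<close> the symbols of \<open>b\<close> and \<open>h\<close> are exact, and the correction \<open>g\<close> stays below \<open>N\<close>. The
    successor makes \<open>N - 1\<close> a genuine index.\<close>
  define N where "N = Suc (N1 + N2 + m + d)"
  have gX: "g (divpow j) \<in> below N" for j
  proof (cases "j < N2")
    case True
    then show ?thesis using m by (auto intro: below_mono simp: N_def)
  next
    case False
    then show ?thesis by (simp add: g_def bX integral_divpow below_closed)
  qed
  have gN: "g p \<in> below N" for p
    using ex_below[of p] poly_End_below[OF gE gX] by blast
  define v where "v j = (b ^^ j) u" for j
  have diag: "dcoeff (v (Suc j)) (Suc i) = dcoeff (v j) i" if "Suc i \<ge> N" for i j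
  proof -
    have "dcoeff (g (v j)) (Suc i) = 0" using below_D[OF gN that] .
    then show ?thesis by (simp add: g_def v_def dcoeff_integral)
  qed
  have diag': "dcoeff (v (j + k)) (N - 1 + k) = dcoeff (v j) (N - 1)" for j k
    by (induction k) (simp_all add: diag N_def)
  define \<pi> :: "'a poly \<Rightarrow> 'a poly" where "\<pi> = (\<lambda>p. \<Sum>i<N. smult (dcoeff p i) (divpow i))"
  have \<pi>E: "\<pi> \<in> poly_End"
    unfolding \<pi>_def by (intro poly_End_sum_fun dcoeff_End)
  have \<pi>N: "\<pi> p \<in> below N" for p
    unfolding \<pi>_def by (intro below_sum below_closed divpow_below) simp
  have \<pi>id: "\<pi> p = p" if "p \<in> below N" for p
    using divpow_expansion[OF that] by (simp add: \<pi>_def)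
  have \<pi>X: "\<pi> (divpow n) = (if n < N then divpow n else 0)" for n
  proof (cases "n < N")
    case True
    then show ?thesis by (simp add: \<pi>id divpow_below)
  next
    case False
    then show ?thesis by (simp add: \<pi>_def)
  qed
  have \<pi>coeff: "dcoeff (\<pi> p) i = dcoeff p i" if "i < N" for p i
  proof -
    have "dcoeff (\<pi> p) i = (\<Sum>k<N. if i = k then dcoeff p k else 0)"
      unfolding \<pi>_def dcoeff_sum by (intro sum.cong) auto
    then show ?thesis using that by simp
  qed
  have \<pi>b: "\<pi> (b p) = \<pi> (b (\<pi> p))" for p
  proof -
    have "\<pi> \<circ> b = \<pi> \<circ> b \<circ> \<pi>"
    proof (rule poly_End_eqI)
      fix n
      show "(\<pi> \<circ> b) (divpow n) = (\<pi> \<circ> b \<circ> \<pi>) (divpow n)"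
        using bX[of n] by (auto simp: \<pi>X poly_End_0[OF bE] poly_End_0[OF \<pi>E] N_def)
    qed (intro poly_End_comp \<pi>E bE)+
    from fun_cong[OF this, of p] show ?thesis by (simp only: o_apply)
  qed
  have \<pi>h: "\<pi> (h p) = \<pi> (h (\<pi> p)) + (\<Sum>k\<in>{1..d}. smult (dcoeff p (N - 1 + k)) (\<pi> (h (divpow (N - 1 + k)))))" for p
  proof -
    have "\<pi> \<circ> h = (\<lambda>p. (\<pi> \<circ> h \<circ> \<pi>) p + (\<Sum>k\<in>{1..d}. smult (dcoeff p (N - 1 + k)) (\<pi> (h (divpow (N - 1 + k))))))"
    proof (rule poly_End_eqI)
      fix n
      let ?s = "\<Sum>k\<in>{1..d}. smult (dcoeff (divpow n) (N - 1 + k)) (\<pi> (h (divpow (N - 1 + k))))"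
      have "?s = (\<Sum>k\<in>{1..d}. if k = n - (N - 1) \<and> n \<ge> N then \<pi> (h (divpow n)) else 0)"
        by (intro sum.cong) (auto simp: N_def)
      also have "\<dots> = (if n \<ge> N \<and> n - (N - 1) \<le> d then \<pi> (h (divpow n)) else 0)"
        by (cases "n \<ge> N") (auto simp: N_def)
      finally have s: "?s = (if n \<ge> N \<and> n - (N - 1) \<le> d then \<pi> (h (divpow n)) else 0)" .
      \<comment> \<open>As \<open>h\<close> lowers indices by at most \<open>d\<close>, basis vectors from \<open>N + d\<close> on do not reach below \<open>N\<close>.\<close>
      have far: "\<pi> (h (divpow n)) = 0" if n: "n \<ge> N" "\<not> n - (N - 1) \<le> d"
      proof (rule poly_eqI_dcoeff)
        fix i
        show "dcoeff (\<pi> (h (divpow n))) i = dcoeff 0 i"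
        proof (cases "i < N")
          case True
          then have "\<not> \<bar>int i - int n\<bar> \<le> int d" using n by auto
          then have "Hs (int i - int n) = 0" using d by blast
          then show ?thesis using True n by (simp add: \<pi>coeff N1 N_def)
        next
          case False
          then show ?thesis using below_D[OF \<pi>N] by simp
        qed
      qed
      show "(\<pi> \<circ> h) (divpow n) = (\<pi> \<circ> h \<circ> \<pi>) (divpow n) + ?s"
        unfolding s using far by (auto simp: \<pi>X poly_End_0[OF hE] poly_End_0[OF \<pi>E])
    qed (intro poly_End_comp poly_End_plus poly_End_sum_fun dcoeff_End \<pi>E hE)+
    from fun_cong[OF this, of p] show ?thesis by (simp only: o_apply)
  qed
  define w where "w j = \<pi> (v j)" for j
  have wstep: "w (Suc j) = (\<pi> \<circ> b) (w j)" for j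
    using \<pi>b[of "v j"] by (simp add: w_def v_def)
  have wN: "w j \<in> below N" for j by (simp add: w_def \<pi>N)
  obtain B' k where B': "B' \<in> poly_End" "\<And>m. m \<ge> k \<Longrightarrow> w m = B' (w (Suc m))"
    by (rule orbit_reversible[where B = "\<pi> \<circ> b" and w = w and N = N, OF poly_End_comp[OF \<pi>E bE] wN wstep]) (rule that)
  have wback: "w m = (B' ^^ n) (w (m + n))" if "m \<ge> k" for m n
  proof (induction n)
    case (Suc n)
    have "w (m + n) = B' (w (Suc (m + n)))" using that by (intro B'(2)) simp
    then show ?case using Suc by (simp add: funpow_swap1)
  qed simp
  define D where "D = (\<lambda>q. (\<pi> \<circ> h) q + (\<Sum>n\<in>{1..d}. smult (dcoeff ((B' ^^ n) q) (N - 1)) (\<pi> (h (divpow (N - 1 + n))))))"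
  have DE: "D \<in> poly_End"
  proof -
    have "(\<lambda>q. smult (dcoeff ((B' ^^ n) q) (N - 1)) y) \<in> poly_End" for n y
      using poly_End_comp[OF dcoeff_End poly_End_funpow[OF B'(1)], of "N - 1" y n]
      by (simp add: comp_def)
    then show ?thesis
      unfolding D_def by (intro poly_End_plus poly_End_comp poly_End_sum_fun \<pi>E hE)
  qed
  have Dw: "D (w j) = smult (of_nat (Suc j)) (w j)" if j: "j \<ge> k + d" for j
  proof -
    have "smult (of_nat (Suc j)) (w j) = \<pi> (h (v j))"
      unfolding w_def v_def h_b_pow[OF u] poly_End_smult[OF \<pi>E] ..
    also have "\<dots> = \<pi> (h (w j)) + (\<Sum>n\<in>{1..d}. smult (dcoeff (v j) (N - 1 + n)) (\<pi> (h (divpow (N - 1 + n)))))"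
      by (simp only: \<pi>h[of "v j"] w_def)
    also have "\<dots> = D (w j)"
    proof -
      have "dcoeff (v j) (N - 1 + n) = dcoeff ((B' ^^ n) (w j)) (N - 1)" if "n \<in> {1..d}" for n
      proof -
        have n: "j - n \<ge> k" "j - n + n = j" using that j by auto
        have "dcoeff (v j) (N - 1 + n) = dcoeff (v (j - n)) (N - 1)"
          using diag'[of "j - n" n] n by simp
        also have "\<dots> = dcoeff (w (j - n)) (N - 1)"
          by (simp add: w_def \<pi>coeff N_def)
        also have "w (j - n) = (B' ^^ n) (w j)"
          using wback[OF n(1), of n] n(2) by simp
        finally show ?thesis .
      qed
      then show ?thesis by (simp add: D_def)
    qed
    finally show ?thesis ..
  qed
  let ?E = "{e::nat. \<exists>w\<in>below N. w \<noteq> 0 \<and> D w = smult (of_nat e) w}"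
  obtain m' where m': "\<forall>e\<in>?E. e \<le> m'"
    using finite_eigenvalues[OF DE, of N] finite_nat_set_iff_bounded_le by blast
  define J where "J = m' + k + d"
  have "w J = 0"
  proof (rule ccontr)
    assume "w J \<noteq> 0"
    then have "Suc J \<in> ?E" using Dw[of J] wN[of J] by (auto simp: J_def)
    then have "Suc J \<le> m'" using m' by blast
    then show False by (simp add: J_def)
  qed
  then have "dcoeff ((b ^^ J) u) i = 0" if "i < N" for i
    using \<pi>coeff[OF that, of "v J"] by (simp add: w_def v_def)
  moreover have "\<bar>e\<bar> \<le> int N" if "Hs e \<noteq> 0" for e using d[OF that] by (simp add: N_def)
  ultimately show thesis
    using that[of N J] gN bX N1 by (simp add: g_def N_def)
qed

text \<open>For an eigenvector \<open>v\<close> of \<open>h\<close> without coefficients below \<open>N\<close>, the lowest term of \<open>h v\<close> would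
  lie below the lowest term of \<open>v\<close> if the symbol of \<open>h\<close> had components of negative index. So \<open>h\<close>
  is diagonal from \<open>N\<close> on with distinct eigenvalues, and \<open>v\<close> is a multiple of a basis vector.\<close>

lemma orbit_eventually_shift:
  assumes B: "has_symbol b (monomial_symbol 1 1)" and Hs: "has_symbol h Hs"
    and const: "\<forall>d. d \<noteq> 0 \<longrightarrow> (\<exists>k. Hs d = [:k:])" and pos: "\<forall>d>0. Hs d = 0" and Hs0: "Hs 0 = [:c, 1:]"
    and u: "a u = 0" "u \<noteq> 0"
  obtains J m t where "t \<noteq> 0" "\<And>n. (b ^^ (J + n)) u = smult t (divpow (m + n))"
proof -
  obtain N J where N: "\<And>p. b p - poly_integral p \<in> below N" "\<And>j. j \<ge> N \<Longrightarrow> b (divpow j) = divpow (Suc j)"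
    "\<And>i j. j \<ge> N \<Longrightarrow> dcoeff (h (divpow j)) i = poly (Hs (int i - int j)) (of_nat j)"
    "\<And>d. Hs d \<noteq> 0 \<Longrightarrow> \<bar>d\<bar> \<le> int N"
    "\<And>i. i < N \<Longrightarrow> dcoeff ((b ^^ J) u) i = 0"
    using low_part_vanishes[OF B Hs u(1)] by blast
  let ?v = "(b ^^ J) u"
  have v0: "?v \<noteq> 0" using b_pow_inj u(2) by blast
  then obtain M where M: "dcoeff ?v M \<noteq> 0" "?v \<in> below (Suc M)" by (rule nonzero_top)
  have hv: "dcoeff (h ?v) i = (\<Sum>n<Suc M. dcoeff ?v n * poly (Hs (int i - int n)) (of_nat n))" for i
  proof -
    have "dcoeff (h ?v) i = (\<Sum>n<Suc M. dcoeff ?v n * dcoeff (h (divpow n)) i)"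
      by (simp only: poly_End_expansion[OF hE M(2)] dcoeff_sum dcoeff_simps)
    also have "\<dots> = (\<Sum>n<Suc M. dcoeff ?v n * poly (Hs (int i - int n)) (of_nat n))"
      using N(3,5) by (intro sum.cong refl) (metis mult_zero_left not_less)
    finally show ?thesis .
  qed
  have ev: "dcoeff (h ?v) i = of_nat (Suc J) * dcoeff ?v i" for i
    by (simp only: h_b_pow[OF u(1)] dcoeff_simps)
  have neg: "Hs d = 0" if "d < 0" for d
  proof (rule ccontr)
    assume "Hs d \<noteq> 0"
    have fin: "finite {d. Hs d \<noteq> 0}" using Hs by (simp add: has_symbol_def)
    \<comment> \<open>The lowest component \<open>e\<close> of the symbol, applied to the lowest term \<open>s\<close> of the eigenvector,
      produces a term of index \<open>s + e\<close> that nothing can cancel.\<close>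
    define e where "e = Min {d. Hs d \<noteq> 0}"
    have e: "Hs e \<noteq> 0" "\<And>d. Hs d \<noteq> 0 \<Longrightarrow> e \<le> d" "e < 0"
      using Min_in[OF fin] Min_le[OF fin] \<open>Hs d \<noteq> 0\<close> \<open>d < 0\<close> unfolding e_def by force+
    obtain k where k: "Hs e = [:k:]" "k \<noteq> 0" using const[rule_format, of e] e(1,3) by auto
    define s where "s = (LEAST s. dcoeff ?v s \<noteq> 0)"
    have s: "dcoeff ?v s \<noteq> 0" unfolding s_def using M(1) by (rule LeastI)
    have s0: "dcoeff ?v j = 0" if "j < s" for j
      using that not_less_Least unfolding s_def by blast
    have "s \<ge> N" using s N(5) by (meson not_less)
    then have i: "int (nat (int s + e)) = int s + e" using N(4)[OF e(1)] e(3) by simp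
    have "s < Suc M" using s below_D[OF M(2)] by (meson not_less)
    have "dcoeff (h ?v) (nat (int s + e)) = (\<Sum>n<Suc M. if n = s then dcoeff ?v s * k else 0)"
      unfolding hv i
    proof (intro sum.cong refl)
      fix n
      show "dcoeff ?v n * poly (Hs (int s + e - int n)) (of_nat n) = (if n = s then dcoeff ?v s * k else 0)"
      proof (cases n s rule: linorder_cases)
        case less
        then show ?thesis by (simp add: s0)
      next
        case equal
        then show ?thesis by (simp add: k)
      next
        case greater
        then have "Hs (int s + e - int n) = 0" using e(2)[of "int s + e - int n"] by force
        then show ?thesis using greater by simp
      qed
    qed
    also have "\<dots> = dcoeff ?v s * k" using \<open>s < Suc M\<close> by (subst sum.delta) simp_all
    finally have "dcoeff ?v (nat (int s + e)) \<noteq> 0" using s k(2) by (auto simp: ev)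
    moreover have "nat (int s + e) < s" using i e(3) by linarith
    ultimately show False using s0 by blast
  qed
  have "Hs d = (if d = 0 then [:c, 1:] else 0)" for d
    using neg pos Hs0 by (metis linorder_neqE_linordered_idom)
  then have "dcoeff (h ?v) i = (\<Sum>n<Suc M. if n = i then dcoeff ?v i * (c + of_nat i) else 0)" for i
    unfolding hv by (intro sum.cong) auto
  then have coeff: "dcoeff ?v i * (c + of_nat i) = of_nat (Suc J) * dcoeff ?v i" if "i < Suc M" for i
    using that by (simp add: ev[symmetric] del: of_nat_Suc sum.lessThan_Suc)
  have only: "i = M" if i: "dcoeff ?v i \<noteq> 0" for i
  proof -
    have "i < Suc M" using i below_D[OF M(2)] by (meson not_less)
    then have "c + of_nat i = of_nat (Suc J)" using coeff[of i] i by (metis mult.commute mult_left_cancel)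
    moreover have "c + of_nat M = of_nat (Suc J)" using coeff[of M] M(1) by (metis lessI mult.commute mult_left_cancel)
    ultimately have "(of_nat i :: 'a) = of_nat M" by (metis add_left_cancel)
    then show ?thesis by simp
  qed
  have v: "?v = smult (dcoeff ?v M) (divpow M)"
    by (rule poly_eqI_dcoeff) (use only in auto)
  have "M \<ge> N" using M(1) N(5) by (meson not_less)
  have "(b ^^ (J + n)) u = smult (dcoeff ?v M) (divpow (M + n))" for n
  proof (induction n)
    case 0
    then show ?case using v by simp
  next
    case (Suc n)
    then show ?case using \<open>M \<ge> N\<close> by (simp add: poly_End_smult[OF bE] N(2))
  qed
  then show thesis using that M(1) by blast
qed

end

section \<open>Endomorphisms as conjugations\<close>

context I1_triple
begin

text \<open>The relations are homogeneous: \<open>a\<close> and \<open>b\<close> may be multiplied by inverse scalars.\<close>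

lemma rescaled_triple:
  assumes "l \<noteq> 0"
  shows "I1_triple (\<lambda>p. smult (1 / l) (a p)) (\<lambda>p. smult l (b p)) h"
proof
  show "(\<lambda>p. smult (1 / l) (a p)) \<in> poly_End" "(\<lambda>p. smult l (b p)) \<in> poly_End" "h \<in> poly_End"
    by (intro poly_End_scale aE bE hE)+
  show "(\<lambda>p. smult (1 / l) (a p)) \<in> I1" "(\<lambda>p. smult l (b p)) \<in> I1" "h \<in> I1"
    by (intro I1_closed aI bI hI)+
  show "smult (1 / l) (a (smult l (b p))) = p" for p
    using assms by (simp add: poly_End_smult[OF aE] ab)
  show "h (smult (1 / l) (a p)) = smult (1 / l) (a (h p)) - smult (1 / l) (a p)" for p
    by (simp add: poly_End_smult[OF hE] ha smult_diff_right)
  show "h (smult l (b p)) = smult l (b (h p)) + smult l (b p)" for p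
    by (simp add: poly_End_smult[OF hE] hb smult_add_right)
  show "h p = p" if "smult (1 / l) (a p) = 0" for p
    using that assms h_ker by simp
qed

text \<open>The rescaling makes the symbol of \<open>b\<close> that of the integral. The orbit map of the rescaled
  triple is then a multiple of a shift in large degrees, and so is its inverse.\<close>

lemma intertwining_unit:
  obtains l \<phi> where "l \<noteq> 0" "\<phi> \<in> I1" "inv \<phi> \<in> I1" "bij \<phi>"
    "\<phi> \<circ> poly_integral = (\<lambda>p. smult l (b p)) \<circ> \<phi>"
    "\<phi> \<circ> pderiv = (\<lambda>p. smult (1 / l) (a p)) \<circ> \<phi>"
    "\<phi> \<circ> euler = h \<circ> \<phi>"
proof -
  obtain l Hs c u where l: "l \<noteq> 0" and B: "has_symbol b (monomial_symbol [:1 / l:] 1)"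
    and Hs: "has_symbol h Hs" "\<forall>d>0. Hs d = 0" "Hs 0 = [:c, 1:]" "\<And>d. d \<noteq> 0 \<Longrightarrow> \<exists>k. Hs d = [:k:]"
    and u: "u \<noteq> 0" "a u = 0" and ker: "\<And>p. a p = 0 \<Longrightarrow> \<exists>k. p = smult k u"
    using symbols_of_triple by metis
  define a' b' where "a' = (\<lambda>p. smult (1 / l) (a p))" and "b' = (\<lambda>p. smult l (b p))"
  interpret r: I1_triple a' b' h
    unfolding a'_def b'_def by (rule rescaled_triple[OF l])
  have u': "a' u = 0" using u by (simp add: a'_def)
  have ker': "\<exists>k. p = smult k u" if "a' p = 0" for p
    using that l ker by (simp add: a'_def)
  have "(\<lambda>d. smult l (monomial_symbol [:1 / l:] 1 d)) = monomial_symbol 1 1"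
    using l by (auto simp: monomial_symbol_def fun_eq_iff one_pCons)
  then have B': "has_symbol b' (monomial_symbol 1 1)"
    using symbol_scale[OF B, of l] by (simp add: b'_def)
  define \<phi> where "\<phi> = combination (\<lambda>n. (b' ^^ n) u)"
  note \<phi> = r.intertwining_orbit_map[OF u(1) u' ker' r.locally_nilpotent, folded \<phi>_def]
  have E: "\<phi> \<in> poly_End" by (simp add: \<phi>_def combination_End)
  obtain J m t where t: "t \<noteq> 0" "\<And>n. (b' ^^ (J + n)) u = smult t (divpow (m + n))"
    by (rule r.orbit_eventually_shift[OF B' Hs(1) _ Hs(2,3) u' u(1)]) (use Hs(4) that in blast)+
  have X: "\<phi> (divpow (J + n)) = smult t (divpow (m + n))" for n
    by (simp add: \<phi>_def t(2))
  have "\<phi> \<in> I1"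
    by (rule eventual_shift_in_I1[of \<phi> 0 J t m, OF E]) (rule X)
  moreover have "inv \<phi> \<in> I1"
  proof (rule eventual_shift_in_I1[of _ 0 m "1 / t" J])
    show Ei: "inv \<phi> \<in> poly_End" by (rule bij_poly_End_inv[OF E \<phi>(4)])
    show "inv \<phi> (divpow (m + n)) = smult (1 / t) (divpow (J + n))" for n
    proof -
      have "divpow (J + n) = inv \<phi> (\<phi> (divpow (J + n)))"
        using \<phi>(4) by (simp add: bij_is_inj)
      then show ?thesis using t(1) by (simp add: X poly_End_smult[OF Ei])
    qed
  qed
  ultimately show thesis
    using that[OF l] \<phi> unfolding a'_def b'_def by blast
qed

lemma intertwining_bij:
  obtains \<psi> where "\<psi> \<in> poly_End" "bij \<psi>" "\<psi> \<circ> poly_integral = b \<circ> \<psi>"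
    "\<psi> \<circ> pderiv = a \<circ> \<psi>" "\<psi> \<circ> euler = h \<circ> \<psi>"
proof -
  obtain u where u: "u \<noteq> 0" "a u = 0" and ker: "\<And>p. a p = 0 \<Longrightarrow> \<exists>k. p = smult k u"
    using symbols_of_triple by metis
  show thesis
    using that[OF combination_End] intertwining_orbit_map[OF u ker locally_nilpotent] by blast
qed

end

lemma pderiv_integral: "pderiv (poly_integral p) = p"
  by (rule poly_eqI) (simp add: coeff_pderiv coeff_poly_integral del: of_nat_Suc)

lemma euler_eq: "euler p = p + pCons 0 (pderiv p)"
  by (simp add: euler_def mult_x_def pderiv_pCons)

lemma integral_euler: "poly_integral (euler p) = pCons 0 p"
  using fun_cong[OF mult_x_eq, of p] by (simp add: mult_x_def)

lemma euler_pderiv: "euler (pderiv p) = pderiv (euler p) - pderiv p"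
  by (simp add: euler_eq pderiv_add pderiv_pCons)

lemma euler_integral: "euler (poly_integral p) = poly_integral (euler p) + poly_integral p"
  by (simp add: integral_euler) (simp add: euler_eq pderiv_integral)

lemma euler_kernel: "euler (p - poly_integral (pderiv p)) = p - poly_integral (pderiv p)"
  by (simp add: poly_End_diff[OF I1_End[OF euler_I1]]) (simp add: euler_eq pderiv_integral)

text \<open>All relations are images of relations between \<open>pderiv\<close>, \<open>poly_integral\<close> and \<open>euler\<close>. The one on
  the kernel comes from \<open>H e = e\<close> for \<open>e = 1 - I d\<close>, since \<open>\<sigma> e\<close> fixes the kernel of \<open>\<sigma> d\<close>.\<close>

lemma endomorphism_triple:
  fixes \<sigma> :: "('a::field_char_0 poly \<Rightarrow> 'a poly) \<Rightarrow> ('a poly \<Rightarrow> 'a poly)"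
  assumes \<sigma>: "algebra_endomorphism I1 \<sigma>"
  shows "I1_triple (\<sigma> pderiv) (\<sigma> poly_integral) (\<sigma> euler)"
proof -
  have mem: "\<And>f. f \<in> I1 \<Longrightarrow> \<sigma> f \<in> I1"
    and add: "\<And>f g. f \<in> I1 \<Longrightarrow> g \<in> I1 \<Longrightarrow> \<sigma> (\<lambda>p. f p + g p) = (\<lambda>p. \<sigma> f p + \<sigma> g p)"
    and scale: "\<And>c f. f \<in> I1 \<Longrightarrow> \<sigma> (\<lambda>p. smult c (f p)) = (\<lambda>p. smult c (\<sigma> f p))"
    and comp: "\<And>f g. f \<in> I1 \<Longrightarrow> g \<in> I1 \<Longrightarrow> \<sigma> (f \<circ> g) = \<sigma> f \<circ> \<sigma> g"
    and one: "\<sigma> id = id"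
    using \<sigma> by (auto simp: algebra_endomorphism_def)
  have diff: "\<sigma> (\<lambda>p. f p - g p) = (\<lambda>p. \<sigma> f p - \<sigma> g p)" if "f \<in> I1" "g \<in> I1" for f g
    using add[OF that(1) I1_closed(6)[OF that(2), of "- 1"]] scale[OF that(2), of "- 1"] by simp
  note I = I1_closed(2,3,4) euler_I1
  define e where "e = (\<lambda>p :: 'a poly. id p - (poly_integral \<circ> pderiv) p)"
  have e: "e \<in> I1" unfolding e_def by (intro I1_diff I1_closed)
  show ?thesis
  proof
    show "\<sigma> pderiv \<in> poly_End" "\<sigma> poly_integral \<in> poly_End" "\<sigma> euler \<in> poly_End"
      "\<sigma> pderiv \<in> I1" "\<sigma> poly_integral \<in> I1" "\<sigma> euler \<in> I1"
      using mem I I1_End by blast+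
    have "pderiv \<circ> poly_integral = (id :: 'a poly \<Rightarrow> 'a poly)"
      by (simp add: fun_eq_iff pderiv_integral)
    then show "\<sigma> pderiv (\<sigma> poly_integral p) = p" for p
      using fun_cong[OF comp[OF I(1,2)], of p] by (simp add: one)
    have "euler \<circ> pderiv = (\<lambda>p :: 'a poly. (pderiv \<circ> euler) p - pderiv p)"
      by (simp add: fun_eq_iff euler_pderiv)
    then have "\<sigma> euler \<circ> \<sigma> pderiv = (\<lambda>p. (\<sigma> pderiv \<circ> \<sigma> euler) p - \<sigma> pderiv p)"
      by (metis comp[OF I(4,1)] comp[OF I(1,4)] diff[OF I1_closed(7)[OF I(1,4)] I(1)])
    then show "\<sigma> euler (\<sigma> pderiv p) = \<sigma> pderiv (\<sigma> euler p) - \<sigma> pderiv p" for p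
      by (simp add: fun_eq_iff)
    have "euler \<circ> poly_integral = (\<lambda>p :: 'a poly. (poly_integral \<circ> euler) p + poly_integral p)"
      by (simp add: fun_eq_iff euler_integral)
    then have "\<sigma> euler \<circ> \<sigma> poly_integral = (\<lambda>p. (\<sigma> poly_integral \<circ> \<sigma> euler) p + \<sigma> poly_integral p)"
      by (metis comp[OF I(4,2)] comp[OF I(2,4)] add[OF I1_closed(7)[OF I(2,4)] I(2)])
    then show "\<sigma> euler (\<sigma> poly_integral p) = \<sigma> poly_integral (\<sigma> euler p) + \<sigma> poly_integral p" for p
      by (simp add: fun_eq_iff)
    have "euler \<circ> e = e"
      by (simp add: fun_eq_iff e_def euler_kernel)
    then have he: "\<sigma> euler (\<sigma> e p) = \<sigma> e p" for p
      using fun_cong[OF comp[OF I(4) e], of p] by simp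
    have "\<sigma> e = (\<lambda>p. p - \<sigma> poly_integral (\<sigma> pderiv p))"
      unfolding e_def diff[OF I(3) I1_closed(7)[OF I(2,1)]] comp[OF I(2,1)] one by simp
    then show "\<sigma> euler p = p" if "\<sigma> pderiv p = 0" for p
      using he[of p] that by (simp add: poly_End_0[OF I1_End[OF mem[OF I(2)]]])
  qed
qed

theorem theorem1p1:
  fixes \<sigma> :: "('a::field_char_0 poly \<Rightarrow> 'a poly) \<Rightarrow> ('a poly \<Rightarrow> 'a poly)"
  assumes "algebra_endomorphism I1 \<sigma>"
  shows "algebra_automorphism I1 \<sigma>"
proof -
  have \<sigma>_mem: "\<And>f. f \<in> I1 \<Longrightarrow> \<sigma> f \<in> I1"
    and \<sigma>_add: "\<And>f g. f \<in> I1 \<Longrightarrow> g \<in> I1 \<Longrightarrow> \<sigma> (\<lambda>p. f p + g p) = (\<lambda>p. \<sigma> f p + \<sigma> g p)"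
    and \<sigma>_scale: "\<And>c f. f \<in> I1 \<Longrightarrow> \<sigma> (\<lambda>p. smult c (f p)) = (\<lambda>p. smult c (\<sigma> f p))"
    and \<sigma>_comp: "\<And>f g. f \<in> I1 \<Longrightarrow> g \<in> I1 \<Longrightarrow> \<sigma> (f \<circ> g) = \<sigma> f \<circ> \<sigma> g"
    and \<sigma>_id: "\<sigma> id = id"
    using assms by (auto simp: algebra_endomorphism_def)
  interpret I1_triple "\<sigma> pderiv" "\<sigma> poly_integral" "\<sigma> euler"
    by (rule endomorphism_triple[OF assms])
  have \<sigma>x: "\<sigma> mult_x = \<sigma> poly_integral \<circ> \<sigma> euler"
    unfolding mult_x_eq by (rule \<sigma>_comp[OF I1_closed(3) euler_I1])
  have "inj_on \<sigma> I1"
  proof -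
    obtain \<psi> where \<psi>: "\<psi> \<in> poly_End" "bij \<psi>" "\<psi> \<circ> poly_integral = \<sigma> poly_integral \<circ> \<psi>"
      "\<psi> \<circ> pderiv = \<sigma> pderiv \<circ> \<psi>" "\<psi> \<circ> euler = \<sigma> euler \<circ> \<psi>"
      by (rule intertwining_bij)
    have \<psi>x: "\<psi> \<circ> mult_x = \<sigma> mult_x \<circ> \<psi>"
      unfolding mult_x_eq \<sigma>x[unfolded mult_x_eq] by (metis \<psi>(3,5) comp_assoc)
    have "\<psi> \<circ> f = \<sigma> f \<circ> \<psi>" if "f \<in> gen_subalgebra {mult_x, pderiv, poly_integral}" for f
      using that
    proof (induction rule: gen_subalgebra.induct)
      case (gen f)
      then show ?case using \<psi>(3,4) \<psi>x by (elim insertE emptyE) (simp_all only:)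
    next
      case one
      then show ?case by (simp only: \<sigma>_id id_comp comp_id)
    next
      case (add f g)
      then show ?case
        using \<sigma>_add[of f g]
        by (simp add: I1_def fun_eq_iff poly_End_add[OF \<psi>(1)])
    next
      case (scale f c)
      then show ?case
        using \<sigma>_scale[of f c]
        by (simp add: I1_def fun_eq_iff poly_End_smult[OF \<psi>(1)])
    next
      case (comp f g)
      then show ?case
        using \<sigma>_comp[of f g] unfolding I1_def by (metis comp_assoc)
    qed
    then have conj: "\<psi> \<circ> f = \<sigma> f \<circ> \<psi>" if "f \<in> I1" for f using that by (simp add: I1_def)
    show ?thesis
    proof (rule inj_onI)
      fix f g assume fg: "f \<in> I1" "g \<in> I1" "\<sigma> f = \<sigma> g"
      then have "\<psi> \<circ> f = \<psi> \<circ> g" by (simp add: conj)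
      then show "f = g" using bij_is_inj[OF \<psi>(2)] by (simp add: fun_eq_iff inj_eq)
    qed
  qed
  moreover have "\<sigma> ` I1 = I1"
  proof
    show "\<sigma> ` I1 \<subseteq> I1" using \<sigma>_mem by blast
    obtain l \<phi> where l: "l \<noteq> 0" and \<phi>: "\<phi> \<in> I1" "inv \<phi> \<in> I1" "bij \<phi>"
      "\<phi> \<circ> poly_integral = (\<lambda>p. smult l (\<sigma> poly_integral p)) \<circ> \<phi>"
      "\<phi> \<circ> pderiv = (\<lambda>p. smult (1 / l) (\<sigma> pderiv p)) \<circ> \<phi>" "\<phi> \<circ> euler = \<sigma> euler \<circ> \<phi>"
      by (rule intertwining_unit)
    note E = I1_End[OF \<phi>(1)]
    have [simp]: "\<phi> (inv \<phi> p) = p" "inv \<phi> (\<phi> p) = p" for p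
      using \<phi>(3) by (simp_all add: bij_is_inj bij_is_surj surj_f_inv_f)
    have c: "\<phi> \<circ> f \<circ> inv \<phi> \<in> \<sigma> ` I1" if "f \<in> gen_subalgebra {mult_x, pderiv, poly_integral}" for f
      using that
    proof (induction rule: gen_subalgebra.induct)
      case (gen f)
      have int: "\<phi> (poly_integral p) = smult l (\<sigma> poly_integral (\<phi> p))"
        and der: "\<phi> (pderiv p) = smult (1 / l) (\<sigma> pderiv (\<phi> p))"
        and eul: "\<phi> (euler p) = \<sigma> euler (\<phi> p)" for p
        using \<phi>(4-6) by (simp_all add: fun_eq_iff)
      have mult: "\<phi> (mult_x p) = smult l (\<sigma> mult_x (\<phi> p))" for p
        by (simp add: \<sigma>x int eul mult_x_eq[THEN fun_cong])
      have "\<phi> \<circ> poly_integral \<circ> inv \<phi> = \<sigma> (\<lambda>p. smult l (poly_integral p))"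
        "\<phi> \<circ> pderiv \<circ> inv \<phi> = \<sigma> (\<lambda>p. smult (1 / l) (pderiv p))"
        "\<phi> \<circ> mult_x \<circ> inv \<phi> = \<sigma> (\<lambda>p. smult l (mult_x p))"
        by (simp_all add: \<sigma>_scale I1_closed int der mult fun_eq_iff)
      moreover have "(\<lambda>p. smult l (poly_integral p)) \<in> I1" "(\<lambda>p. smult (1 / l) (pderiv p)) \<in> I1"
        "(\<lambda>p. smult l (mult_x p)) \<in> I1"
        by (intro I1_closed)+
      ultimately show ?case using gen by (elim insertE emptyE) (metis imageI)+
    next
      case one
      have "\<phi> \<circ> id \<circ> inv \<phi> = \<sigma> id" by (simp add: \<sigma>_id fun_eq_iff)
      then show ?case using I1_closed(4) by blast
    next
      case (add f g)
      then obtain f' g' where fg: "f' \<in> I1" "g' \<in> I1" "\<phi> \<circ> f \<circ> inv \<phi> = \<sigma> f'" "\<phi> \<circ> g \<circ> inv \<phi> = \<sigma> g'"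
        by blast
      have "\<phi> \<circ> (\<lambda>p. f p + g p) \<circ> inv \<phi> = (\<lambda>p. \<sigma> f' p + \<sigma> g' p)"
        unfolding fg(3,4)[symmetric] by (simp add: fun_eq_iff poly_End_add[OF E])
      then have "\<phi> \<circ> (\<lambda>p. f p + g p) \<circ> inv \<phi> = \<sigma> (\<lambda>p. f' p + g' p)"
        by (simp only: \<sigma>_add[OF fg(1,2)])
      then show ?case using I1_closed(5)[OF fg(1,2)] by blast
    next
      case (scale f k)
      then obtain f' where f: "f' \<in> I1" "\<phi> \<circ> f \<circ> inv \<phi> = \<sigma> f'" by blast
      have "\<phi> \<circ> (\<lambda>p. smult k (f p)) \<circ> inv \<phi> = (\<lambda>p. smult k (\<sigma> f' p))"
        unfolding f(2)[symmetric] by (simp add: fun_eq_iff poly_End_smult[OF E])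
      then have "\<phi> \<circ> (\<lambda>p. smult k (f p)) \<circ> inv \<phi> = \<sigma> (\<lambda>p. smult k (f' p))"
        by (simp only: \<sigma>_scale[OF f(1)])
      then show ?case using I1_closed(6)[OF f(1)] by blast
    next
      case (comp f g)
      then obtain f' g' where fg: "f' \<in> I1" "g' \<in> I1" "\<phi> \<circ> f \<circ> inv \<phi> = \<sigma> f'" "\<phi> \<circ> g \<circ> inv \<phi> = \<sigma> g'"
        by blast
      have "\<phi> \<circ> (f \<circ> g) \<circ> inv \<phi> = \<sigma> f' \<circ> \<sigma> g'"
        unfolding fg(3,4)[symmetric] by (simp add: fun_eq_iff)
      then have "\<phi> \<circ> (f \<circ> g) \<circ> inv \<phi> = \<sigma> (f' \<circ> g')"
        by (simp only: \<sigma>_comp[OF fg(1,2)])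
      then show ?case using I1_closed(7)[OF fg(1,2)] by blast
    qed
    show "I1 \<subseteq> \<sigma> ` I1"
    proof
      fix g :: "'a poly \<Rightarrow> 'a poly" assume "g \<in> I1"
      then have "inv \<phi> \<circ> g \<circ> \<phi> \<in> I1" by (intro I1_closed(7) \<phi>)
      then have "\<phi> \<circ> (inv \<phi> \<circ> g \<circ> \<phi>) \<circ> inv \<phi> \<in> \<sigma> ` I1" using c by (simp add: I1_def)
      also have "\<phi> \<circ> (inv \<phi> \<circ> g \<circ> \<phi>) \<circ> inv \<phi> = g" by (simp add: fun_eq_iff)
      finally show "g \<in> \<sigma> ` I1" .
    qed
  qed
  ultimately show ?thesis
    using assms by (simp add: algebra_automorphism_def bij_betw_def)
qed

end
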